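(* Let $N\ge 1$ be an integer, let $0<q<1$, and let $0<\gamma<\gamma_N:=\min\{2,N\}$. Let $u_0\in C_0(\mathbb{R}^N)$ with $u_0\ge 0$. Then there exists a non-negative solution of the problem $$u_t-\Delta u=|x|^{-\gamma}u^q\ \text{ in }\mathbb{R}^N\times(0,\infty),\qquad u(x,0)=u_0(x)\ \text{ in }\mathbb{R}^N,$$ that is, there exists a non-negative function $u\in C([0,\infty);C_0(\mathbb{R}^N))$ such that $$u(t)=\mathbf{S}(t)u_0+\int_0^t \mathbf{S}_\gamma(t-\sigma)\,u^q(\sigma)\,d\sigma$$ for every $t\in[0,T]$ and every $0<T<\infty$.
   Context: $C_0(\mathbb{R}^N)$ is the closure in $L^\infty(\mathbb{R}^N)$ of the space of infinitely differentiable functions with compact support in $\mathbb{R}^N$ (real-valued, with the sup norm). $\{\mathbf{S}(t)\}_{t\ge0}$ is the heat semigroup: $\mathbf{S}(0)=I$ and, for $t>0$, $[\mathbf{S}(t)\varphi](x)=(4\pi t)^{-N/2}\int_{\mathbb{R}^N}e^{-|x-y|^2/(4t)}\varphi(y)\,dy$. For $t>0$, $[\mathbf{S}_\gamma(t)\varphi](x)=(4\pi t)^{-N/2}\int_{\mathbb{R}^N}e^{-|x-y|^2/(4t)}|y|^{-\gamma}\varphi(y)\,dy$. Here $u(t)$ denotes the function $u(\cdot,t)$, and $u^q(\sigma)=u(\cdot,\sigma)^q$. *)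

theory Defs
  imports "HOL-Analysis.Analysis"
begin

text \<open>
  \<open>\<real>\<^sup>N\<close> is \<^typ>\<open>real ^ 'n\<close> with \<open>N = CARD('n)\<close>.  Real-valued functions of class \<open>C\<^sup>k\<close> on \<open>\<real>\<^sup>N\<close>,
  by recursion on the directional derivatives \<open>x \<mapsto> Df(x) v\<close>.
\<close>

fun C_k :: "nat \<Rightarrow> (real ^ 'n \<Rightarrow> real) \<Rightarrow> bool" where
  "C_k 0 f \<longleftrightarrow> continuous_on UNIV f"
| "C_k (Suc k) f \<longleftrightarrow> f differentiable_on UNIV \<and>
     (\<forall>v. C_k k (\<lambda>x. frechet_derivative f (at x) v))"

definition test_function :: "(real ^ 'n \<Rightarrow> real) \<Rightarrow> bool" where
  "test_function \<phi> \<longleftrightarrow> (\<forall>k. C_k k \<phi>) \<and> compact (closure {x. \<phi> x \<noteq> 0})"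

text \<open>
  On bounded continuous functions the norm of \<open>L\<^sup>\<infinity>(\<real>\<^sup>N)\<close> is the supremum norm, i.e. the norm of the
  type \<open>(real ^ 'n) \<Rightarrow>\<^sub>C real\<close>, and these functions form a closed subspace of \<open>L\<^sup>\<infinity>(\<real>\<^sup>N)\<close>.  So the
  closure of the test functions in \<open>L\<^sup>\<infinity>(\<real>\<^sup>N)\<close> is their closure in this type; each class is
  represented by its unique continuous representative.
\<close>

definition C0 :: "((real ^ 'n) \<Rightarrow>\<^sub>C real) set" where
  "C0 = closure {\<phi>. test_function (apply_bcontfun \<phi>)}"

definition heat_semigroup :: "real \<Rightarrow> (real ^ 'n \<Rightarrow> real) \<Rightarrow> real ^ 'n \<Rightarrow> real" where
  "heat_semigroup t \<phi> x =
     (if t = 0 then \<phi> x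
      else (4 * pi * t) powr (- real CARD('n) / 2) *
           (LINT y|lborel. exp (- (norm (x - y))\<^sup>2 / (4 * t)) * \<phi> y))"

text \<open>
  The weighted operators are only meant for \<open>t > 0\<close>.  The value \<open>0\<close> that \<^const>\<open>powr\<close> gives to
  \<open>|y|\<^sup>-\<^sup>\<gamma>\<close> at \<open>y = 0\<close> is irrelevant, as it concerns a null set.
\<close>

definition weighted_integrand ::
    "real \<Rightarrow> real \<Rightarrow> (real ^ 'n \<Rightarrow> real) \<Rightarrow> real ^ 'n \<Rightarrow> real ^ 'n \<Rightarrow> real" where
  "weighted_integrand \<gamma> t \<phi> x y =
     exp (- (norm (x - y))\<^sup>2 / (4 * t)) * norm y powr (- \<gamma>) * \<phi> y"

definition weighted_heat :: "real \<Rightarrow> real \<Rightarrow> (real ^ 'n \<Rightarrow> real) \<Rightarrow> real ^ 'n \<Rightarrow> real" where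
  "weighted_heat \<gamma> t \<phi> x =
     (4 * pi * t) powr (- real CARD('n) / 2) * (LINT y|lborel. weighted_integrand \<gamma> t \<phi> x y)"

text \<open>
  Membership of \<open>u\<close> in \<open>C([0,\<infinity>); C\<^sub>0(\<real>\<^sup>N))\<close> and the integral equation, read pointwise in \<open>x\<close>.
  Since \<^const>\<open>lebesgue_integral\<close> is \<open>0\<close> on non-integrable functions, convergence of the integrals
  in \<open>y\<close> and in \<open>\<sigma>\<close> is required explicitly.  The interval integral is taken over the open
  interval, so \<^const>\<open>weighted_heat\<close> occurs at times \<open>t - \<sigma> > 0\<close> only.  Values of \<open>u\<close> at negative
  times play no role.
\<close>

definition mild_solution ::
    "real \<Rightarrow> real \<Rightarrow> ((real ^ 'n) \<Rightarrow>\<^sub>C real) \<Rightarrow> (real \<Rightarrow> ((real ^ 'n) \<Rightarrow>\<^sub>C real)) \<Rightarrow> bool" where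
  "mild_solution q \<gamma> u0 u \<longleftrightarrow>
     continuous_on {0..} u \<and> (\<forall>t\<ge>0. u t \<in> C0) \<and>
     (\<forall>T>0. \<forall>t\<in>{0..T}. \<forall>x.
        (\<forall>\<sigma>\<in>{0<..<t}. integrable lborel
           (weighted_integrand \<gamma> (t - \<sigma>) (\<lambda>y. apply_bcontfun (u \<sigma>) y powr q) x)) \<and>
        interval_lebesgue_integrable lborel (ereal 0) (ereal t)
           (\<lambda>\<sigma>. weighted_heat \<gamma> (t - \<sigma>) (\<lambda>y. apply_bcontfun (u \<sigma>) y powr q) x) \<and>
        apply_bcontfun (u t) x =
          heat_semigroup t (apply_bcontfun u0) x +
          (LBINT \<sigma>=ereal 0..ereal t.
             weighted_heat \<gamma> (t - \<sigma>) (\<lambda>y. apply_bcontfun (u \<sigma>) y powr q) x))"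

end

theory Submission
  imports Defs "HOL-Probability.Distributions"
begin

text \<open>
  Since \<open>s \<mapsto> s\<^sup>q\<close> is monotone, the map \<open>\<Phi>(u)(t) = S(t) u\<^sub>0 + \<integral>\<^sub>0\<^sup>t S\<^sub>\<gamma>(t - \<sigma>) u\<^sup>q(\<sigma>) d\<sigma>\<close> is monotone, and the
  iterates \<open>\<Phi>\<^sup>n(0)\<close> increase. From \<open>S\<^sub>\<gamma>(t) 1 \<le> C t\<^bsup>-\<gamma>/2\<^esup>\<close> with \<open>\<gamma> < 2\<close> and from \<open>q < 1\<close>, a large constant
  \<open>M\<^sub>T\<close> is a supersolution on \<open>[0,T]\<close>, so the iterates converge to a locally bounded fixed point by
  dominated convergence, and no Lipschitz condition is needed. The Duhamel term of any bounded measurable source is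
  continuous in \<open>(t,x)\<close> and vanishes as \<open>|x| \<rightarrow> \<infinity>\<close>, locally uniformly in \<open>t\<close>, because the weight
  \<open>|y|\<^bsup>-\<gamma>\<^esup>\<close> does; hence the fixed point is a continuous path in \<open>C\<^sub>0\<close>.
\<close>

section \<open>Density of test functions\<close>

text \<open>The function \<open>s powr q\<close> has infinite slope at 0 and \<open>u0\<close> may
  vanish, so a contraction argument is not directly available and order replaces it. The price is
  that the fixed point is an increasing limit, a priori only measurable; its continuity and decay
  must be read off the integral equation, so the Duhamel estimates are stated for sources that are
  merely measurable and locally bounded in time. The conditions on \<open>\<gamma>\<close> act
  separately: \<open>\<gamma> < N\<close> makes the weight locally integrable in space and gives the
  scale-invariant bound \<open>t powr (- \<gamma> / 2)\<close>, \<open>\<gamma> < 2\<close> makes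
  that power integrable in time, and \<open>\<gamma> > 0\<close> gives decay at infinity. Both terms
  of the equation are extended to all real times, the heat flow frozen and the Duhamel term zero for
  negative times, so continuity is proved on all of space-time with no boundary at
  \<open>t = 0\<close>.\<close>

definition flat :: "nat \<Rightarrow> real \<Rightarrow> real" where
  "flat j s = (if s > 0 then exp (- (1 / s)) / s ^ j else 0)"

lemma flat_tendsto_0: "(flat j \<longlongrightarrow> 0) (at 0)"
proof -
  have "((\<lambda>x::real. x ^ j / exp x) \<longlongrightarrow> 0) at_top"
    by (rule tendsto_power_div_exp_0)
  then have "((\<lambda>s::real. inverse s ^ j / exp (inverse s)) \<longlongrightarrow> 0) (at_right 0)"
    by (rule filterlim_compose[OF _ filterlim_inverse_at_top_right])
  then have r: "(flat j \<longlongrightarrow> 0) (at_right 0)"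
    by (rule Lim_transform_eventually)
      (auto simp: eventually_at_filter flat_def exp_minus field_simps)
  have l: "(flat j \<longlongrightarrow> 0) (at_left 0)"
    by (rule Lim_transform_eventually[OF tendsto_const]) (auto simp: eventually_at_filter flat_def)
  show ?thesis using l r by (simp add: filterlim_split_at)
qed

text \<open>The denominators in \<open>flat\<close> serve this identity: the span of the family is
  closed under differentiation, so smoothness follows by iteration without computing higher
  derivatives.\<close>

lemma has_real_derivative_flat:
  "(flat j has_real_derivative flat (j + 2) s - real j * flat (j + 1) s) (at s)"
proof (cases s "0 :: real" rule: linorder_cases)
  case greater
  have "((\<lambda>s. s ^ j) has_real_derivative real j * s ^ j / s) (at s)"
    using DERIV_pow[of j s] greater by (cases j) auto
  moreover have "((\<lambda>s. exp (- (1 / s))) has_real_derivative exp (- (1 / s)) / s\<^sup>2) (at s)"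
    using greater by (auto intro!: derivative_eq_intros simp: power2_eq_square)
  ultimately have "((\<lambda>s. exp (- (1 / s)) / s ^ j) has_real_derivative
      (exp (- (1 / s)) / s\<^sup>2 * s ^ j - exp (- (1 / s)) * (real j * s ^ j / s)) / (s ^ j * s ^ j)) (at s)"
    using greater by (intro DERIV_divide) auto
  also have "(exp (- (1 / s)) / s\<^sup>2 * s ^ j - exp (- (1 / s)) * (real j * s ^ j / s)) / (s ^ j * s ^ j) =
      flat (j + 2) s - real j * flat (j + 1) s"
    using greater by (simp add: flat_def field_simps power2_eq_square)
  finally have "((\<lambda>s. exp (- (1 / s)) / s ^ j) has_real_derivative
      flat (j + 2) s - real j * flat (j + 1) s) (at s)" .
  then show ?thesis
    by (rule has_field_derivative_transform_within_open[where S = "{0<..}"])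
      (use greater in \<open>auto simp: flat_def\<close>)
next
  case less
  have "((\<lambda>s. 0) has_real_derivative flat (j + 2) s - real j * flat (j + 1) s) (at s)"
    using less by (simp add: flat_def)
  then show ?thesis
    by (rule has_field_derivative_transform_within_open[where S = "{..<0}"])
      (use less in \<open>auto simp: flat_def\<close>)
next
  case equal
  \<comment> \<open>For nonzero \<open>h\<close> the difference quotient of \<open>flat j\<close> at
    0 is \<open>flat (j + 1) h\<close>, so its limit is already known.\<close>
  have "((\<lambda>h. (flat j (0 + h) - flat j 0) / h) \<longlongrightarrow> 0) (at 0)"
    by (rule Lim_transform_eventually[OF flat_tendsto_0[of "j + 1"]])
      (auto simp: flat_def eventually_at_filter field_simps)
  then have "(flat j has_real_derivative 0) (at 0)"
    by (simp add: DERIV_def)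
  then show ?thesis
    using equal by (simp add: flat_def)
qed

text \<open>
  This class is closed under directional derivatives, so its members satisfy \<^const>\<open>C_k\<close> for every
  \<open>k\<close>; they vanish outside the ball of radius \<open>R\<close>.
\<close>

inductive bump_combination :: "real \<Rightarrow> ('a::euclidean_space \<Rightarrow> real) \<Rightarrow> bool" for R where
  poly: "real_polynomial_function p \<Longrightarrow> bump_combination R (\<lambda>x. p x * flat j (R\<^sup>2 - x \<bullet> x))"
| add: "bump_combination R f \<Longrightarrow> bump_combination R g \<Longrightarrow> bump_combination R (\<lambda>x. f x + g x)"

text \<open>For each fixed direction the derivative is a polynomial in the point; this order of the
  arguments is the one that iterated directional derivatives in \<open>C_k\<close> require.\<close>

lemma real_polynomial_function_derivative:
  fixes p :: "'a::euclidean_space \<Rightarrow> real"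
  assumes "real_polynomial_function p"
  shows "\<exists>p'. (\<forall>v. real_polynomial_function (p' v)) \<and> (\<forall>x. (p has_derivative (\<lambda>v. p' v x)) (at x))"
  using assms
proof induction
  case (linear f)
  show ?case
    by (rule exI[of _ "\<lambda>v x. f v"])
      (auto intro: real_polynomial_function.intros bounded_linear_imp_has_derivative[OF linear])
next
  case (const c)
  show ?case
    by (rule exI[of _ "\<lambda>v x. 0"]) (auto intro: real_polynomial_function.intros)
next
  case (add f g)
  then obtain f' g' where "\<forall>v. real_polynomial_function (f' v)" "\<forall>x. (f has_derivative (\<lambda>v. f' v x)) (at x)"
      "\<forall>v. real_polynomial_function (g' v)" "\<forall>x. (g has_derivative (\<lambda>v. g' v x)) (at x)"
    by blast
  then show ?case
    by (intro exI[of _ "\<lambda>v x. f' v x + g' v x"])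
      (auto intro: real_polynomial_function.intros has_derivative_add)
next
  case (mult f g)
  then obtain f' g' where "\<forall>v. real_polynomial_function (f' v)" "\<forall>x. (f has_derivative (\<lambda>v. f' v x)) (at x)"
      "\<forall>v. real_polynomial_function (g' v)" "\<forall>x. (g has_derivative (\<lambda>v. g' v x)) (at x)"
    by blast
  with mult.hyps show ?case
    by (intro exI[of _ "\<lambda>v x. f x * g' v x + f' v x * g x"] conjI allI has_derivative_mult
        real_polynomial_function.intros(3,4)) auto
qed

text \<open>By the chain rule the inner function contributes the factor
  \<open>- 2 * (x \<bullet> v)\<close>, which is linear in \<open>x\<close>, so every term remains a
  polynomial times some \<open>flat j\<close>.\<close>

lemma bump_combination_derivative:
  fixes f :: "'a::euclidean_space \<Rightarrow> real"
  assumes "bump_combination R f"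
  shows "\<exists>f'. (\<forall>v. bump_combination R (f' v)) \<and> (\<forall>x. (f has_derivative (\<lambda>v. f' v x)) (at x))"
  using assms
proof induction
  case (poly p j)
  then obtain p' where p': "\<And>v. real_polynomial_function (p' v)"
      "\<And>x. (p has_derivative (\<lambda>v. p' v x)) (at x)"
    using real_polynomial_function_derivative by metis
  define f' where "f' v x = p' v x * flat j (R\<^sup>2 - x \<bullet> x) +
     (p x * (-2 * (x \<bullet> v)) * flat (j + 2) (R\<^sup>2 - x \<bullet> x) +
      p x * (2 * real j * (x \<bullet> v)) * flat (j + 1) (R\<^sup>2 - x \<bullet> x))" for v x
  have lin: "real_polynomial_function (\<lambda>x. x \<bullet> v)" for v :: 'a
    by (intro real_polynomial_function.intros(1) bounded_linear_inner_left)
  have "bump_combination R (f' v)" for v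
    unfolding f'_def
    by (intro bump_combination.intros p' real_polynomial_function.intros poly lin)
  moreover have "((\<lambda>x. p x * flat j (R\<^sup>2 - x \<bullet> x)) has_derivative (\<lambda>v. f' v x)) (at x)" for x
  proof -
    have 1: "((\<lambda>x. R\<^sup>2 - x \<bullet> x) has_derivative (\<lambda>v. - 2 * (x \<bullet> v))) (at x)"
      by (auto intro!: derivative_eq_intros simp: inner_commute)
    have "((\<lambda>x. flat j (R\<^sup>2 - x \<bullet> x)) has_derivative
        (\<lambda>v. (- 2 * (x \<bullet> v)) * (flat (j + 2) (R\<^sup>2 - x \<bullet> x) - real j * flat (j + 1) (R\<^sup>2 - x \<bullet> x)))) (at x)"
      using has_derivative_compose[OF 1 has_real_derivative_flat[of j, unfolded has_field_derivative_def]]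
      by (simp add: mult.commute)
    from has_derivative_mult[OF p'(2) this] show ?thesis
      by (rule has_derivative_eq_rhs) (auto simp: f'_def algebra_simps)
  qed
  ultimately show ?case by blast
next
  case (add f g)
  then obtain f' g' where "\<forall>v. bump_combination R (f' v)" "\<forall>x. (f has_derivative (\<lambda>v. f' v x)) (at x)"
      "\<forall>v. bump_combination R (g' v)" "\<forall>x. (g has_derivative (\<lambda>v. g' v x)) (at x)"
    by blast
  then show ?case
    by (intro exI[of _ "\<lambda>v x. f' v x + g' v x"])
      (auto intro: bump_combination.add has_derivative_add)
qed

lemma C_k_bump_combination: "bump_combination R f \<Longrightarrow> C_k k f"
proof (induction k arbitrary: f)
  case 0
  then obtain f' where "\<And>x. (f has_derivative (\<lambda>v. f' v x)) (at x)"
    using bump_combination_derivative by metis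
  then show ?case
    by (auto intro!: continuous_at_imp_continuous_on has_derivative_continuous)
next
  case (Suc k)
  then obtain f' where f': "\<And>v. bump_combination R (f' v)"
      "\<And>x. (f has_derivative (\<lambda>v. f' v x)) (at x)"
    using bump_combination_derivative by metis
  have "frechet_derivative f (at x) = (\<lambda>v. f' v x)" for x
    using frechet_derivative_at[OF f'(2)] by simp
  with f' Suc.IH show ?case
    by (auto simp: differentiable_on_def intro: differentiableI differentiable_at_withinI)
qed

text \<open>
  Divide by a bump that is positive on a ball slightly larger than the support, approximate the
  quotient by a polynomial, and multiply back.
\<close>

lemma test_function_approximation:
  fixes f :: "real ^ 'n \<Rightarrow> real"
  assumes cont: "continuous_on UNIV f" and supp: "\<And>x. r \<le> norm x \<Longrightarrow> f x = 0" and "0 < e"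
  shows "\<exists>g. test_function g \<and> (\<forall>x. \<bar>f x - g x\<bar> \<le> e)"
proof -
  define R where "R = \<bar>r\<bar> + 1"
  define b where "b x = flat 0 (R\<^sup>2 - x \<bullet> x)" for x :: "real ^ 'n"
  have R: "R > 0" "r < R" by (auto simp: R_def)
  have b_pos: "b x > 0" if "norm x < R" for x
    using that R power_strict_mono[of "norm x" R 2]
    by (simp add: b_def flat_def power2_norm_eq_inner)
  have b_0: "b x = 0" if "norm x \<ge> R" for x
    using that R power_mono[of R "norm x" 2]
    by (simp add: b_def flat_def power2_norm_eq_inner)
  have b_le: "0 \<le> b x" "b x \<le> 1" for x by (auto simp: b_def flat_def)
  have b_cont: "continuous_on A b" for A
  proof -
    have "bump_combination R (\<lambda>x. 1 * b x)"
      unfolding b_def by (intro bump_combination.intros real_polynomial_function.intros)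
    from C_k_bump_combination[OF this, of 0] show ?thesis
      by (auto intro: continuous_on_subset)
  qed
  \<comment> \<open>The bump is positive on the first set and the numerator vanishes on the second,
    where the quotient is 0 even if the bump is 0 too, because division by zero yields 0. The open
    sets overlap since \<open>r < R\<close>.\<close>
  have "continuous_on ({x. norm x < R} \<union> {x. norm x > r}) (\<lambda>x. f x / b x)"
  proof (rule continuous_on_open_Un)
    show "continuous_on {x. norm x < R} (\<lambda>x. f x / b x)"
      using b_pos by (intro continuous_on_divide continuous_on_subset[OF cont] b_cont) force+
    show "continuous_on {x. norm x > r} (\<lambda>x. f x / b x)"
      by (rule continuous_on_eq[OF continuous_on_const[of _ 0]]) (auto simp: supp)
  qed (auto intro!: open_Collect_less continuous_intros)
  moreover have "{x. norm x < R} \<union> {x. norm x > r} = UNIV" using R by auto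
  ultimately have "continuous_on (cball 0 R) (\<lambda>x. f x / b x)"
    by (auto intro: continuous_on_subset)
  from Stone_Weierstrass_real_polynomial_function[OF compact_cball this \<open>0 < e\<close>]
  obtain p where p: "real_polynomial_function p" "\<And>x. x \<in> cball 0 R \<Longrightarrow> \<bar>f x / b x - p x\<bar> < e"
    by metis
  define g where "g x = p x * b x" for x
  have "bump_combination R g"
    unfolding g_def b_def by (intro bump_combination.intros p)
  then have "\<forall>k. C_k k g" by (simp add: C_k_bump_combination)
  moreover have "compact (closure {x. g x \<noteq> 0})"
  proof -
    have "{x. g x \<noteq> 0} \<subseteq> cball 0 R"
      using b_0 by (force simp: g_def)
    then show ?thesis by (metis bounded_cball bounded_subset compact_closure)
  qed
  moreover have "\<bar>f x - g x\<bar> \<le> e" for x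
  proof (cases "norm x < R")
    case True
    \<comment> \<open>The bump is at most 1, so multiplying back does not enlarge the error of the
      polynomial.\<close>
    have "\<bar>f x - g x\<bar> = b x * \<bar>f x / b x - p x\<bar>"
      using b_pos[OF True] by (simp add: g_def abs_mult_pos' right_diff_distrib mult.commute)
    also have "\<dots> \<le> 1 * e"
      using p(2)[of x] True b_le by (intro mult_mono) auto
    finally show ?thesis by simp
  next
    case False
    then show ?thesis using b_0 supp R \<open>0 < e\<close> by (auto simp: g_def)
  qed
  ultimately show ?thesis unfolding test_function_def by blast
qed

text \<open>This replaces the closure of the test functions by a decay condition that can be checked
  on solutions; later arguments use only this form.\<close>

lemma C0_iff_vanishes_at_infinity:
  fixes f :: "(real ^ 'n) \<Rightarrow>\<^sub>C real"
  shows "f \<in> C0 \<longleftrightarrow> (\<forall>e>0. \<exists>R. \<forall>x. R \<le> norm x \<longrightarrow> \<bar>apply_bcontfun f x\<bar> < e)"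
proof (intro iffI allI impI)
  fix e :: real assume "f \<in> C0" "e > 0"
  then obtain g where g: "test_function (apply_bcontfun g)" "dist g f < e"
    unfolding C0_def closure_approachable by auto
  then have "bounded {x. apply_bcontfun g x \<noteq> 0}"
    by (auto simp: test_function_def intro: bounded_subset[OF _ closure_subset] compact_imp_bounded)
  then obtain R where R: "\<And>x. apply_bcontfun g x \<noteq> 0 \<Longrightarrow> norm x \<le> R"
    by (auto simp: bounded_iff)
  have "\<bar>apply_bcontfun f x\<bar> < e" if "R + 1 \<le> norm x" for x
  proof -
    have "apply_bcontfun g x = 0" using R[of x] that by force
    with dist_fun_lt_imp_dist_val_lt[OF g(2), of x] show ?thesis by (simp add: dist_real_def)
  qed
  then show "\<exists>R. \<forall>x. R \<le> norm x \<longrightarrow> \<bar>apply_bcontfun f x\<bar> < e" by blast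
next
  assume van: "\<forall>e>0. \<exists>R. \<forall>x. R \<le> norm x \<longrightarrow> \<bar>apply_bcontfun f x\<bar> < e"
  show "f \<in> C0"
    unfolding C0_def closure_approachable
  proof (intro allI impI)
    fix e :: real assume "e > 0"
    then obtain R where R: "\<And>x. R \<le> norm x \<Longrightarrow> \<bar>apply_bcontfun f x\<bar> < e / 4"
      using van[rule_format, of "e / 4"] by auto
    \<comment> \<open>Subtracting the truncation of \<open>f\<close> at height \<open>e / 4\<close>
      keeps continuity, moves \<open>f\<close> by at most \<open>e / 4\<close>, and gives 0 wherever
      \<open>f\<close> is that small, hence outside a ball.\<close>
    define h where "h x = apply_bcontfun f x - max (- (e / 4)) (min (e / 4) (apply_bcontfun f x))" for x
    have "continuous_on UNIV h"
      unfolding h_def by (intro continuous_intros) auto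
    moreover have "h x = 0" if "R \<le> norm x" for x
      using R[OF that] by (auto simp: h_def)
    ultimately obtain g where g: "test_function g" "\<And>x. \<bar>h x - g x\<bar> \<le> e / 4"
      using test_function_approximation[of h R "e / 4"] \<open>e > 0\<close> by auto
    have fh: "\<bar>apply_bcontfun f x - h x\<bar> \<le> e / 4" for x
      using \<open>e > 0\<close> by (auto simp: h_def)
    have fg: "\<bar>apply_bcontfun f x - g x\<bar> \<le> e / 2" for x
      using fh[of x] g(2)[of x] by linarith
    have "g \<in> bcontfun"
    proof -
      have "continuous_on UNIV g" using g(1) by (auto simp: test_function_def dest: spec[of _ 0])
      moreover have "bounded (range g)"
      proof -
        obtain B where B: "\<And>x. norm (apply_bcontfun f x) \<le> B"
          using bounded_apply_bcontfun[of f] by (auto simp: bounded_iff)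
        have "norm (g x) \<le> B + e / 2" for x
          using B[of x] fg[of x] unfolding real_norm_def by linarith
        then show ?thesis by (auto simp: bounded_iff)
      qed
      ultimately show ?thesis by (simp add: bcontfun_def)
    qed
    then have "apply_bcontfun (Bcontfun g) = g" by (simp add: Bcontfun_inverse)
    moreover from this fg have "dist (Bcontfun g) f \<le> e / 2"
      by (intro dist_bound) (simp add: dist_real_def abs_minus_commute)
    ultimately show "\<exists>y\<in>{\<phi>. test_function (apply_bcontfun \<phi>)}. dist y f < e"
      using g(1) \<open>e > 0\<close> by (intro bexI[of _ "Bcontfun g"]) auto
  qed
qed

section \<open>Heat kernel estimates\<close>

definition heat_kernel :: "real \<Rightarrow> 'a::euclidean_space \<Rightarrow> real" where
  "heat_kernel t z = (4 * pi * t) powr (- real DIM('a) / 2) * exp (- (norm z)\<^sup>2 / (4 * t))"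

lemma heat_kernel_nonneg [simp]: "0 \<le> heat_kernel t z"
  by (simp add: heat_kernel_def)

lemma borel_measurable_heat_kernel [measurable]:
  assumes [measurable]: "f \<in> borel_measurable M" "g \<in> borel_measurable M"
  shows "(\<lambda>p. heat_kernel (f p) (g p)) \<in> borel_measurable M"
  unfolding heat_kernel_def by measurable

text \<open>This reduces the total mass of the kernel to one-dimensional Gaussian integrals; each
  coordinate has variance \<open>2 * t\<close>.\<close>

lemma heat_kernel_eq_prod:
  fixes x y :: "'a::euclidean_space"
  assumes "t > 0"
  shows "heat_kernel t (x - y) = (\<Prod>b\<in>Basis. normal_density (x \<bullet> b) (sqrt (2 * t)) (y \<bullet> b))"
proof -
  have "(norm (x - y))\<^sup>2 = (\<Sum>b\<in>Basis. (y \<bullet> b - x \<bullet> b)\<^sup>2)"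
    by (subst norm_minus_commute, subst power2_norm_eq_inner, subst euclidean_inner)
      (simp add: power2_eq_square inner_diff_left)
  then have "exp (- (norm (x - y))\<^sup>2 / (4 * t)) = (\<Prod>b\<in>Basis. exp (- (y \<bullet> b - x \<bullet> b)\<^sup>2 / (4 * t)))"
    by (simp add: exp_sum[symmetric] sum_divide_distrib sum_negf[symmetric])
  moreover have "(4 * pi * t) powr (- real DIM('a) / 2) = (1 / sqrt (4 * pi * t)) ^ DIM('a)"
  proof -
    have "1 / sqrt (4 * pi * t) = (4 * pi * t) powr (- 1 / 2)"
      using assms by (simp add: powr_minus_divide powr_half_sqrt)
    then show ?thesis
      using assms by (simp add: powr_power)
  qed
  ultimately show ?thesis
    using assms by (simp add: heat_kernel_def normal_density_def prod_dividef power_divide mult.assoc)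
qed

lemma nn_integral_heat_kernel:
  fixes x :: "'a::euclidean_space"
  assumes "t > 0"
  shows "(\<integral>\<^sup>+y. ennreal (heat_kernel t (x - y)) \<partial>lborel) = 1"
proof -
  have "(\<integral>\<^sup>+y. ennreal (heat_kernel t (x - y)) \<partial>lborel) =
      (\<integral>\<^sup>+y. (\<Prod>b\<in>Basis. ennreal (normal_density (x \<bullet> b) (sqrt (2 * t)) (y \<bullet> b))) \<partial>lborel)"
    by (simp add: heat_kernel_eq_prod[OF assms] prod_ennreal)
  also have "\<dots> = (\<Prod>b\<in>(Basis::'a set).
      \<integral>\<^sup>+s. ennreal (normal_density (x \<bullet> b) (sqrt (2 * t)) s) \<partial>lborel)"
    by (intro nn_integral_lborel_prod) auto
  also have "\<dots> = 1"
    using assms by (simp add: nn_integral_eq_integral)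
  finally show ?thesis .
qed

text \<open>Sum over the dyadic shells \<open>r / 2\<^bsup>k+1\<^esup> < |y| \<le> r / 2\<^bsup>k\<^esup>\<close>.\<close>

lemma nn_integral_norm_powr_cball:
  assumes "0 \<le> \<gamma>" "\<gamma> < real DIM('a)"
  shows "\<exists>C\<ge>0. \<forall>r>0. (\<integral>\<^sup>+y. ennreal (norm y powr - \<gamma>) * indicator (cball (0::'a::euclidean_space) r) y \<partial>lborel)
    \<le> ennreal (C * r powr (real DIM('a) - \<gamma>))"
proof -
  let ?N = "DIM('a)"
  define v where "v = unit_ball_vol (real ?N)"
  \<comment> \<open>Ratio of the bounds for consecutive shells: halving the radius multiplies the
    weight by \<open>2 powr \<gamma>\<close> and the volume by \<open>2 powr (- N)\<close>. It is
    below 1 because \<open>\<gamma> < N\<close>.\<close>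
  define \<rho> where "\<rho> = 2 powr (\<gamma> - real ?N)"
  have v: "v \<ge> 0" by (simp add: v_def)
  have [measurable]: "cball (0::'a) s \<in> sets borel" for s by simp
  have \<rho>: "0 < \<rho>" "\<rho> < 1"
    using assms powr_less_mono[of "\<gamma> - real ?N" 0 2] by (auto simp: \<rho>_def)
  have "(\<integral>\<^sup>+y. ennreal (norm y powr - \<gamma>) * indicator (cball (0::'a) r) y \<partial>lborel)
      \<le> ennreal (v * 2 powr \<gamma> * (1 / (1 - \<rho>)) * r powr (real ?N - \<gamma>))" if r: "r > 0" for r
  proof -
    \<comment> \<open>The weight at the inner radius of shell \<open>k\<close> bounds it on that
      shell. It is charged to the whole ball of the outer radius, which costs only a constant factor
      and keeps the volumes explicit.\<close>
    define a where "a k = (r / 2 ^ Suc k) powr - \<gamma>" for k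
    have pw: "ennreal (norm y powr - \<gamma>) * indicator (cball 0 r) y
        \<le> (\<Sum>k. ennreal (a k) * indicator (cball 0 (r / 2 ^ k)) y)" for y :: 'a
    proof (cases "y = 0 \<or> norm y > r")
      \<comment> \<open>At the origin the left side is 0, because \<open>powr\<close> with base 0 is
        0.\<close>
      case True
      then show ?thesis by auto
    next
      case False
      define k where "k = (LEAST k. r / 2 ^ Suc k < norm y)"
      obtain n where "r / norm y < 2 ^ n"
        using real_arch_pow[of 2 "r / norm y"] by auto
      also have "(2::real) ^ n \<le> 2 ^ Suc n" by simp
      finally have ex: "r / 2 ^ Suc n < norm y"
        using False by (simp add: field_simps)
      have k: "r / 2 ^ Suc k < norm y"
        unfolding k_def by (rule LeastI[of "\<lambda>k. r / 2 ^ Suc k < norm y", OF ex])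
      have k': "norm y \<le> r / 2 ^ k"
      proof (cases k)
        case 0
        then show ?thesis using False by simp
      next
        case (Suc m)
        then have "\<not> r / 2 ^ Suc m < norm y"
          using not_less_Least[of m "\<lambda>k. r / 2 ^ Suc k < norm y"] by (simp add: k_def)
        then show ?thesis using Suc by simp
      qed
      have "norm y powr - \<gamma> \<le> a k"
        unfolding a_def using k r assms(1) by (intro powr_mono2') auto
      then have "ennreal (norm y powr - \<gamma>) * indicator (cball 0 r) y
          \<le> ennreal (a k) * indicator (cball 0 (r / 2 ^ k)) y"
        using False k' by (auto simp: indicator_def intro!: ennreal_leI)
      also have "\<dots> \<le> (\<Sum>k. ennreal (a k) * indicator (cball 0 (r / 2 ^ k)) y)"
      proof -
        define g where "g k = ennreal (a k) * indicator (cball 0 (r / 2 ^ k)) y" for k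
        show ?thesis using sum_le_suminf[of g "{k}"] by (simp flip: g_def)
      qed
      finally show ?thesis .
    qed
    have eq: "a k * (v * (r / 2 ^ k) ^ ?N) = v * 2 powr \<gamma> * r powr (real ?N - \<gamma>) * \<rho> ^ k" for k
    proof -
      have "a k = (r powr - \<gamma>) * 2 powr \<gamma> * 2 powr (\<gamma> * real k)"
        unfolding a_def using r
        by (simp add: powr_divide powr_minus powr_realpow[symmetric] powr_powr powr_mult powr_add
            del: power_Suc add: power_Suc[symmetric])
          (simp add: field_simps powr_add flip: powr_realpow powr_powr)
      moreover have "(r / 2 ^ k) ^ ?N = r powr real ?N * 2 powr (- real ?N * real k)"
      proof -
        have "2 powr (- real ?N * real k) = 1 / 2 ^ (k * ?N)"
          by (simp add: powr_minus_divide mult.commute flip: powr_realpow)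
        then show ?thesis using r by (simp add: power_divide power_mult powr_realpow)
      qed
      moreover have "\<rho> ^ k = 2 powr (\<gamma> * real k) * 2 powr (- real ?N * real k)"
        unfolding \<rho>_def by (simp add: powr_power flip: powr_add) (simp add: algebra_simps)
      moreover have "r powr (real ?N - \<gamma>) = r powr real ?N * r powr - \<gamma>"
        by (simp flip: powr_add)
      ultimately show ?thesis by (simp only: mult_ac)
    qed
    have "(\<integral>\<^sup>+y. ennreal (norm y powr - \<gamma>) * indicator (cball (0::'a) r) y \<partial>lborel)
        \<le> (\<integral>\<^sup>+y. (\<Sum>k. ennreal (a k) * indicator (cball (0::'a) (r / 2 ^ k)) y) \<partial>lborel)"
      by (intro nn_integral_mono pw)
    also have "\<dots> = (\<Sum>k. \<integral>\<^sup>+y. ennreal (a k) * indicator (cball (0::'a) (r / 2 ^ k)) y \<partial>lborel)"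
      by (rule nn_integral_suminf) measurable
    also have "\<dots> = (\<Sum>k. ennreal (v * 2 powr \<gamma> * r powr (real ?N - \<gamma>) * \<rho> ^ k))"
      using r by (simp add: nn_integral_cmult_indicator emeasure_cball v_def[symmetric] eq[symmetric]
          a_def v ennreal_mult')
    also have "\<dots> = ennreal (v * 2 powr \<gamma> * r powr (real ?N - \<gamma>) * (1 / (1 - \<rho>)))"
      using \<rho> v by (intro suminf_ennreal_eq sums_mult geometric_sums) auto
    finally show ?thesis by (simp add: mult_ac)
  qed
  moreover have "0 \<le> v * 2 powr \<gamma> * (1 / (1 - \<rho>))" using v \<rho> by simp
  ultimately show ?thesis by blast
qed

lemma heat_kernel_le: "t > 0 \<Longrightarrow> heat_kernel t (z::'a::euclidean_space) \<le> (4 * pi * t) powr (- real DIM('a) / 2)"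
  by (simp add: heat_kernel_def mult_left_le)

text \<open>
  Split at \<open>|y| = sqrt t\<close>: inside, the heat kernel is at most a multiple of \<open>t\<^bsup>-N/2\<^esup>\<close>; outside, the weight
  is at most \<open>t\<^bsup>-\<gamma>/2\<^esup>\<close>.
\<close>

lemma nn_integral_heat_kernel_weighted:
  assumes "0 \<le> \<gamma>" "\<gamma> < real DIM('a)"
  shows "\<exists>C\<ge>0. \<forall>t>0. \<forall>x::'a::euclidean_space.
    (\<integral>\<^sup>+y. ennreal (heat_kernel t (x - y) * norm y powr - \<gamma>) \<partial>lborel) \<le> ennreal (C * t powr (- \<gamma> / 2))"
proof -
  let ?N = "real DIM('a)"
  obtain C where C: "C \<ge> 0" "\<And>r. r > 0 \<Longrightarrow>
      (\<integral>\<^sup>+y. ennreal (norm y powr - \<gamma>) * indicator (cball (0::'a) r) y \<partial>lborel) \<le> ennreal (C * r powr (?N - \<gamma>))"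
    using nn_integral_norm_powr_cball[where 'a = 'a, OF assms] by blast
  have [measurable]: "cball (0::'a) s \<in> sets borel" for s by simp
  have "(\<integral>\<^sup>+y. ennreal (heat_kernel t (x - y) * norm y powr - \<gamma>) \<partial>lborel) \<le> ennreal ((C + 1) * t powr (- \<gamma> / 2))"
    if t: "t > 0" for t and x :: 'a
  proof -
    define c where "c = (4 * pi * t) powr (- ?N / 2)"
    have c: "c \<ge> 0" by (simp add: c_def)
    have "(\<integral>\<^sup>+y. ennreal (heat_kernel t (x - y) * norm y powr - \<gamma>) \<partial>lborel)
      \<le> (\<integral>\<^sup>+y. ennreal c * (ennreal (norm y powr - \<gamma>) * indicator (cball 0 (sqrt t)) y)
            + ennreal (t powr (- \<gamma> / 2)) * ennreal (heat_kernel t (x - y)) \<partial>lborel)"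
    proof (rule nn_integral_mono)
      fix y :: 'a
      show "ennreal (heat_kernel t (x - y) * norm y powr - \<gamma>)
        \<le> ennreal c * (ennreal (norm y powr - \<gamma>) * indicator (cball 0 (sqrt t)) y)
            + ennreal (t powr (- \<gamma> / 2)) * ennreal (heat_kernel t (x - y))"
      proof (cases "norm y \<le> sqrt t")
        case True
        have "heat_kernel t (x - y) * norm y powr - \<gamma> \<le> c * norm y powr - \<gamma>"
          unfolding c_def using heat_kernel_le[OF t] by (intro mult_right_mono) auto
        with True c show ?thesis
          by (simp add: ennreal_mult'[symmetric] add_increasing2 ennreal_leI)
      next
        case False
        have "norm y powr - \<gamma> \<le> sqrt t powr - \<gamma>"
          using False t assms(1) by (intro powr_mono2') auto
        also have "sqrt t powr - \<gamma> = t powr (- \<gamma> / 2)"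
          using t by (simp add: powr_half_sqrt[symmetric] powr_powr)
        finally have "heat_kernel t (x - y) * norm y powr - \<gamma> \<le> t powr (- \<gamma> / 2) * heat_kernel t (x - y)"
          by (metis heat_kernel_nonneg mult.commute mult_right_mono)
        then show ?thesis
          by (simp add: ennreal_mult'[symmetric] add_increasing ennreal_leI)
      qed
    qed
    also have "\<dots> = ennreal c * (\<integral>\<^sup>+y. ennreal (norm y powr - \<gamma>) * indicator (cball (0::'a) (sqrt t)) y \<partial>lborel)
         + ennreal (t powr (- \<gamma> / 2)) * (\<integral>\<^sup>+y. ennreal (heat_kernel t (x - y)) \<partial>lborel)"
    proof -
      have 1: "(\<lambda>y. ennreal (norm y powr - \<gamma>) * indicator (cball (0::'a) (sqrt t)) y) \<in> borel_measurable lborel"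
        and 2: "(\<lambda>y. ennreal (heat_kernel t (x - y))) \<in> borel_measurable lborel"
        by measurable
      show ?thesis
        by (subst nn_integral_add[OF borel_measurable_times_ennreal borel_measurable_times_ennreal, OF borel_measurable_const 1 borel_measurable_const 2])
          (simp only: nn_integral_cmult[OF 1] nn_integral_cmult[OF 2])
    qed
    also have "\<dots> = ennreal c * (\<integral>\<^sup>+y. ennreal (norm y powr - \<gamma>) * indicator (cball (0::'a) (sqrt t)) y \<partial>lborel)
         + ennreal (t powr (- \<gamma> / 2))"
      by (simp add: nn_integral_heat_kernel[OF t])
    also have "\<dots> \<le> ennreal c * ennreal (C * sqrt t powr (?N - \<gamma>)) + ennreal (t powr (- \<gamma> / 2))"
      using t by (intro add_right_mono mult_left_mono C) auto
    also have "\<dots> = ennreal (c * (C * sqrt t powr (?N - \<gamma>)) + t powr (- \<gamma> / 2))"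
      using c C(1) by (simp add: ennreal_mult' ennreal_plus)
    also have "\<dots> \<le> ennreal ((C + 1) * t powr (- \<gamma> / 2))"
    proof (rule ennreal_leI)
      \<comment> \<open>The factor \<open>t powr (?N / 2)\<close> from the ball of radius
        \<open>sqrt t\<close> cancels the normalisation of the kernel, leaving the scale-invariant
        power.\<close>
      have "sqrt t powr (?N - \<gamma>) = t powr (?N / 2) * t powr (- \<gamma> / 2)"
        using t by (simp add: powr_half_sqrt[symmetric] powr_powr powr_add[symmetric] diff_divide_distrib)
      moreover have "c \<le> t powr (- ?N / 2)"
      proof -
        have "t \<le> 4 * pi * t" using pi_gt3 t by simp
        then show ?thesis unfolding c_def using t by (intro powr_mono2') auto
      qed
      then have "c * t powr (?N / 2) \<le> t powr (- ?N / 2) * t powr (?N / 2)"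
        by (rule mult_right_mono) auto
      moreover have "t powr (- ?N / 2) * t powr (?N / 2) = 1"
        using t by (simp flip: powr_add)
      ultimately have "c * sqrt t powr (?N - \<gamma>) \<le> t powr (- \<gamma> / 2)"
        using mult_right_mono[of "c * t powr (?N / 2)" 1 "t powr (- \<gamma> / 2)"]
        by (simp add: mult.assoc)
      from mult_left_mono[OF this C(1)]
      show "c * (C * sqrt t powr (?N - \<gamma>)) + t powr (- \<gamma> / 2) \<le> (C + 1) * t powr (- \<gamma> / 2)"
        by (simp add: algebra_simps)
    qed
    finally show ?thesis .
  qed
  with C(1) show ?thesis by (intro exI[of _ "C + 1"]) auto
qed

text \<open>
  For \<open>|y| \<ge> R\<close> the weight is small; for \<open>|y| < R\<close> one has \<open>|x - y| \<ge> R\<close>, and trading half of the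
  Gaussian exponent for a kernel at time \<open>2t\<close> gains the factor \<open>exp (- R\<^sup>2 / (8 t)) \<le> 8 t / R\<^sup>2\<close>.
\<close>

lemma nn_integral_heat_kernel_weighted_decay:
  assumes "0 \<le> \<gamma>" "\<gamma> < real DIM('a)"
  shows "\<exists>C\<ge>0. \<forall>t>0. \<forall>R>0. \<forall>x::'a::euclidean_space. 2 * R \<le> norm x \<longrightarrow>
    (\<integral>\<^sup>+y. ennreal (heat_kernel t (x - y) * norm y powr - \<gamma>) \<partial>lborel)
      \<le> ennreal (R powr - \<gamma> + C * t powr (1 - \<gamma> / 2) / R\<^sup>2)"
proof -
  let ?N = "real DIM('a)"
  obtain C where C: "C \<ge> 0" "\<And>t (x::'a). t > 0 \<Longrightarrow>
      (\<integral>\<^sup>+y. ennreal (heat_kernel t (x - y) * norm y powr - \<gamma>) \<partial>lborel) \<le> ennreal (C * t powr (- \<gamma> / 2))"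
    using nn_integral_heat_kernel_weighted[where 'a = 'a, OF assms] by blast
  \<comment> \<open>The factor 8 comes from \<open>exp (- s) \<le> 1 / s \<le> 8 * t / R^2\<close>,
    the power of 2 from the quotient of the normalisations at times \<open>t\<close> and
    \<open>2 * t\<close>.\<close>
  define K where "K = 8 * 2 powr (?N / 2)"
  have K: "K > 0" by (simp add: K_def)
  have "(\<integral>\<^sup>+y. ennreal (heat_kernel t (x - y) * norm y powr - \<gamma>) \<partial>lborel)
      \<le> ennreal (R powr - \<gamma> + (K * C * 2 powr (- \<gamma> / 2)) * t powr (1 - \<gamma> / 2) / R\<^sup>2)"
    if t: "t > 0" and R: "R > 0" and x: "2 * R \<le> norm x" for t R and x :: 'a
  proof -
    have "(\<integral>\<^sup>+y. ennreal (heat_kernel t (x - y) * norm y powr - \<gamma>) \<partial>lborel)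
      \<le> (\<integral>\<^sup>+y. ennreal (R powr - \<gamma>) * ennreal (heat_kernel t (x - y))
            + ennreal (K * t / R\<^sup>2) * ennreal (heat_kernel (2 * t) (x - y) * norm y powr - \<gamma>) \<partial>lborel)"
    proof (rule nn_integral_mono)
      fix y :: 'a
      show "ennreal (heat_kernel t (x - y) * norm y powr - \<gamma>)
        \<le> ennreal (R powr - \<gamma>) * ennreal (heat_kernel t (x - y))
            + ennreal (K * t / R\<^sup>2) * ennreal (heat_kernel (2 * t) (x - y) * norm y powr - \<gamma>)"
      proof (cases "R \<le> norm y")
        case True
        have "norm y powr - \<gamma> \<le> R powr - \<gamma>"
          using True R assms(1) by (intro powr_mono2') auto
        then have "heat_kernel t (x - y) * norm y powr - \<gamma> \<le> R powr - \<gamma> * heat_kernel t (x - y)"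
          by (metis heat_kernel_nonneg mult.commute mult_right_mono)
        then show ?thesis
          by (simp add: ennreal_mult'[symmetric] add_increasing2 ennreal_leI)
      next
        case False
        define s where "s = (norm (x - y))\<^sup>2 / (8 * t)"
        have "R \<le> norm (x - y)"
          using False x norm_triangle_ineq2[of x y] by simp
        then have "R\<^sup>2 / (8 * t) \<le> s" unfolding s_def
          using R t by (intro divide_right_mono power_mono) auto
        moreover have Rt: "R\<^sup>2 / (8 * t) > 0" using R t by simp
        ultimately have s: "s > 0" "1 / s \<le> 8 * t / R\<^sup>2"
          using frac_le[of 1 1 "R\<^sup>2 / (8 * t)" s] by auto
        have "s \<le> exp s"
          by (rule order_trans[OF _ exp_ge_add_one_self]) simp
        then have "exp (- s) \<le> 1 / s"
          using s(1) by (simp add: exp_minus field_simps)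
        with s have e: "exp (- s) \<le> 8 * t / R\<^sup>2" by linarith
        have "(4 * pi * t) powr (- ?N / 2) = 2 powr (?N / 2) * (4 * pi * (2 * t)) powr (- ?N / 2)"
        proof -
          have "4 * pi * (2 * t) = 2 * (4 * pi * t)" by simp
          then have "(4 * pi * (2 * t)) powr (- ?N / 2) = 2 powr (- ?N / 2) * (4 * pi * t) powr (- ?N / 2)"
            by (simp only: powr_mult)
          then show ?thesis by (simp add: mult.assoc[symmetric] flip: powr_add)
        qed
        moreover have "exp (- (norm (x - y))\<^sup>2 / (4 * t)) = exp (- s) * exp (- (norm (x - y))\<^sup>2 / (4 * (2 * t)))"
          using t by (simp add: s_def field_simps flip: exp_add)
        ultimately have "heat_kernel t (x - y) = 2 powr (?N / 2) * exp (- s) * heat_kernel (2 * t) (x - y)"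
          by (simp add: heat_kernel_def)
        also have "\<dots> \<le> 2 powr (?N / 2) * (8 * t / R\<^sup>2) * heat_kernel (2 * t) (x - y)"
          using e by (intro mult_right_mono mult_left_mono) auto
        finally have "heat_kernel t (x - y) * norm y powr - \<gamma> \<le>
            (K * t / R\<^sup>2) * (heat_kernel (2 * t) (x - y) * norm y powr - \<gamma>)"
          unfolding mult.assoc[symmetric] by (intro mult_right_mono) (auto simp: K_def mult_ac)
        then show ?thesis
          using K t by (simp add: ennreal_mult'[symmetric] add_increasing ennreal_leI)
      qed
    qed
    also have "\<dots> = ennreal (R powr - \<gamma>) +
        ennreal (K * t / R\<^sup>2) * (\<integral>\<^sup>+y. ennreal (heat_kernel (2 * t) (x - y) * norm y powr - \<gamma>) \<partial>lborel)"
      using nn_integral_heat_kernel[OF t, of x] by (simp add: nn_integral_add nn_integral_cmult)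
    also have "\<dots> \<le> ennreal (R powr - \<gamma>) + ennreal (K * t / R\<^sup>2) * ennreal (C * (2 * t) powr (- \<gamma> / 2))"
      using t by (intro add_left_mono mult_left_mono C) auto
    also have "\<dots> = ennreal (R powr - \<gamma> + K * t / R\<^sup>2 * (C * (2 * t) powr (- \<gamma> / 2)))"
      using K t C(1) by (simp add: ennreal_mult'[symmetric] flip: ennreal_plus)
    also have "K * t / R\<^sup>2 * (C * (2 * t) powr (- \<gamma> / 2)) =
        (K * C * 2 powr (- \<gamma> / 2)) * t powr (1 - \<gamma> / 2) / R\<^sup>2"
    proof -
      have "t powr (1 - \<gamma> / 2) = t * t powr (- \<gamma> / 2)"
        using t powr_add[of t 1 "- \<gamma> / 2"] by simp
      then show ?thesis using t by (simp add: powr_mult)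
    qed
    finally show ?thesis .
  qed
  moreover have "0 \<le> K * C * 2 powr (- \<gamma> / 2)" using K C(1) by simp
  ultimately show ?thesis by blast
qed

section \<open>The Duhamel integral\<close>

lemma nn_integral_lborel_pair:
  fixes g :: "'a::euclidean_space \<times> 'b::euclidean_space \<Rightarrow> ennreal"
  assumes "g \<in> borel_measurable borel"
  shows "(\<integral>\<^sup>+p. g p \<partial>lborel) = (\<integral>\<^sup>+s. \<integral>\<^sup>+y. g (s, y) \<partial>lborel \<partial>lborel)"
  using lborel.nn_integral_fst[of g "lborel :: 'a measure"] assms by (simp add: lborel_prod)

lemma borel_measurable_fst_snd [measurable]:
  "fst \<in> borel_measurable (borel :: ('a::euclidean_space \<times> 'b::euclidean_space) measure)"
  "snd \<in> borel_measurable (borel :: ('a::euclidean_space \<times> 'b::euclidean_space) measure)"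
  by (auto intro!: borel_measurable_continuous_onI continuous_intros)

text \<open>
  The integrals in \<open>y\<close> and \<open>\<sigma>\<close> are merged into one Lebesgue integral over space-time points
  \<open>p = (\<sigma>, y)\<close>, with \<open>z = (t, x)\<close> as parameter.
\<close>

definition duhamel_kernel :: "real \<Rightarrow> real \<times> 'a::euclidean_space \<Rightarrow> real \<times> 'a \<Rightarrow> real" where
  "duhamel_kernel \<gamma> z p = (if 0 < fst p \<and> fst p < fst z
     then heat_kernel (fst z - fst p) (snd z - snd p) * norm (snd p) powr - \<gamma> else 0)"

lemma duhamel_kernel_nonneg [simp]: "0 \<le> duhamel_kernel \<gamma> z p"
  by (simp add: duhamel_kernel_def)

lemma borel_measurable_duhamel_kernel [measurable]: "duhamel_kernel \<gamma> z \<in> borel_measurable borel"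
  unfolding duhamel_kernel_def[abs_def] by measurable

text \<open>A factor depending on time alone leaves the spatial integral. It will be the indicator
  of a time window, or the constant 1.\<close>

lemma nn_integral_duhamel_kernel:
  fixes x :: "'a::euclidean_space"
  assumes [measurable]: "g \<in> borel_measurable borel"
  shows "(\<integral>\<^sup>+p. ennreal (duhamel_kernel \<gamma> (t, x) p) * g (fst p) \<partial>lborel) =
    (\<integral>\<^sup>+s. (g s * indicator {0<..<t} s) *
      (\<integral>\<^sup>+y. ennreal (heat_kernel (t - s) (x - y) * norm y powr - \<gamma>) \<partial>lborel) \<partial>lborel)"
proof -
  have "(\<integral>\<^sup>+p. ennreal (duhamel_kernel \<gamma> (t, x) p) * g (fst p) \<partial>lborel) =
     (\<integral>\<^sup>+s. \<integral>\<^sup>+y. (g s * indicator {0<..<t} s) *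
        ennreal (heat_kernel (t - s) (x - y) * norm y powr - \<gamma>) \<partial>lborel \<partial>lborel)"
    by (subst nn_integral_lborel_pair)
      (auto intro!: nn_integral_cong simp: duhamel_kernel_def mult.commute split: split_indicator)
  also have "\<dots> = (\<integral>\<^sup>+s. (g s * indicator {0<..<t} s) *
      (\<integral>\<^sup>+y. ennreal (heat_kernel (t - s) (x - y) * norm y powr - \<gamma>) \<partial>lborel) \<partial>lborel)"
    by (intro nn_integral_cong nn_integral_cmult) measurable
  finally show ?thesis .
qed

lemma nn_integral_powr_reflected:
  assumes "a < 1" "0 \<le> \<delta>"
  shows "(\<integral>\<^sup>+s. ennreal ((t - s) powr - a) * indicator {t - \<delta>..t} s \<partial>lborel) =
    ennreal (\<delta> powr (1 - a) / (1 - a))"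
proof -
  have "(\<integral>\<^sup>+s. ennreal ((t - s) powr - a) * indicator {t - \<delta>..t} s \<partial>lborel) =
      ennreal \<bar>- 1\<bar> * (\<integral>\<^sup>+s. ennreal ((t - (t + (- 1) * s)) powr - a) *
        indicator {t - \<delta>..t} (t + (- 1) * s) \<partial>lborel)"
    by (rule nn_integral_real_affine) auto
  also have "\<dots> = (\<integral>\<^sup>+s. ennreal (s powr - a) * indicator {0..\<delta>} s \<partial>lborel)"
    by (auto intro!: nn_integral_cong split: split_indicator)
  also have "\<dots> = ennreal (\<delta> powr (1 - a) / (1 - a))"
    using has_integral_powr_from_0[of "- a" \<delta>] assms
    by (intro nn_integral_has_integral_lebesgue') auto
  finally show ?thesis .
qed

text \<open>The spatial bound \<open>(t - s) powr - (\<gamma> / 2)\<close> is integrable up to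
  \<open>s = t\<close> because \<open>\<gamma> < 2\<close>. The window length is a parameter with
  two uses: a long window contains the whole mass, a short one measures what a cutoff near the final
  time removes.\<close>

lemma nn_integral_duhamel_kernel_le:
  assumes "0 \<le> \<gamma>" "\<gamma> < min 2 (real DIM('a))"
  shows "\<exists>C\<ge>0. \<forall>t. \<forall>x::'a::euclidean_space. \<forall>\<delta>\<ge>0.
    (\<integral>\<^sup>+p. ennreal (duhamel_kernel \<gamma> (t, x) p) * indicator {t - \<delta>..} (fst p) \<partial>lborel)
      \<le> ennreal (C * \<delta> powr (1 - \<gamma> / 2))"
proof -
  obtain C where C: "C \<ge> 0" "\<And>t (x::'a). t > 0 \<Longrightarrow>
      (\<integral>\<^sup>+y. ennreal (heat_kernel t (x - y) * norm y powr - \<gamma>) \<partial>lborel) \<le> ennreal (C * t powr (- \<gamma> / 2))"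
    using nn_integral_heat_kernel_weighted[where 'a = 'a and \<gamma> = \<gamma>] assms by auto
  have C2: "(\<integral>\<^sup>+y. ennreal (heat_kernel (t - s) (x - y) * norm y powr - \<gamma>) \<partial>lborel)
      \<le> ennreal C * ennreal ((t - s) powr - (\<gamma> / 2))" if "s < t" for s t and x :: 'a
    using C(2)[of "t - s" x] C(1) that by (simp add: ennreal_mult'[symmetric])
  have "(\<integral>\<^sup>+p. ennreal (duhamel_kernel \<gamma> (t, x) p) * indicator {t - \<delta>..} (fst p) \<partial>lborel)
      \<le> ennreal (C / (1 - \<gamma> / 2) * \<delta> powr (1 - \<gamma> / 2))" if "\<delta> \<ge> 0" for t \<delta> and x :: 'a
  proof -
    have "(\<integral>\<^sup>+p. ennreal (duhamel_kernel \<gamma> (t, x) p) * indicator {t - \<delta>..} (fst p) \<partial>lborel)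
      \<le> (\<integral>\<^sup>+s. ennreal C * (ennreal ((t - s) powr - (\<gamma> / 2)) * indicator {t - \<delta>..t} s) \<partial>lborel)"
      by (subst nn_integral_duhamel_kernel)
        (auto intro!: nn_integral_mono C2 split: split_indicator)
    also have "\<dots> = ennreal C * ennreal (\<delta> powr (1 - \<gamma> / 2) / (1 - \<gamma> / 2))"
      using assms that by (subst nn_integral_cmult) (simp_all add: nn_integral_powr_reflected)
    also have "\<dots> = ennreal (C / (1 - \<gamma> / 2) * \<delta> powr (1 - \<gamma> / 2))"
      using C(1) by (simp flip: ennreal_mult')
    finally show ?thesis .
  qed
  moreover have "C / (1 - \<gamma> / 2) \<ge> 0" using C(1) assms by simp
  ultimately show ?thesis by blast
qed

lemma integrable_duhamel_kernel:
  fixes z :: "real \<times> 'a::euclidean_space"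
  assumes "0 \<le> \<gamma>" "\<gamma> < min 2 (real DIM('a))"
  shows "integrable lborel (duhamel_kernel \<gamma> z)"
proof (rule integrableI_nonneg)
  obtain C where C: "\<And>t (x::'a) \<delta>. \<delta> \<ge> 0 \<Longrightarrow>
    (\<integral>\<^sup>+p. ennreal (duhamel_kernel \<gamma> (t, x) p) * indicator {t - \<delta>..} (fst p) \<partial>lborel)
      \<le> ennreal (C * \<delta> powr (1 - \<gamma> / 2))"
    using nn_integral_duhamel_kernel_le[OF assms] by blast
  have "(\<integral>\<^sup>+p. ennreal (duhamel_kernel \<gamma> z p) \<partial>lborel) =
     (\<integral>\<^sup>+p. ennreal (duhamel_kernel \<gamma> (fst z, snd z) p) * indicator {fst z - max 0 (fst z)..} (fst p) \<partial>lborel)"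
    by (auto intro!: nn_integral_cong simp: duhamel_kernel_def max_def split: split_indicator)
  also have "\<dots> < \<infinity>"
    using C[of "max 0 (fst z)" "fst z" "snd z"] by (auto intro: le_less_trans)
  finally show "(\<integral>\<^sup>+p. ennreal (duhamel_kernel \<gamma> z p) \<partial>lborel) < \<infinity>" .
qed (auto simp: borel_measurable_duhamel_kernel)

lemma integral_duhamel_kernel_le:
  assumes "0 \<le> \<gamma>" "\<gamma> < min 2 (real DIM('a))"
  shows "\<exists>C\<ge>0. \<forall>t. \<forall>x::'a::euclidean_space. \<forall>\<delta>\<ge>0.
    (\<integral>p. duhamel_kernel \<gamma> (t, x) p * indicator {t - \<delta>..} (fst p) \<partial>lborel) \<le> C * \<delta> powr (1 - \<gamma> / 2)"
proof -
  obtain C where C: "C \<ge> 0" "\<And>t (x::'a) \<delta>. \<delta> \<ge> 0 \<Longrightarrow>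
    (\<integral>\<^sup>+p. ennreal (duhamel_kernel \<gamma> (t, x) p) * indicator {t - \<delta>..} (fst p) \<partial>lborel)
      \<le> ennreal (C * \<delta> powr (1 - \<gamma> / 2))"
    using nn_integral_duhamel_kernel_le[OF assms] by blast
  have "(\<integral>p. duhamel_kernel \<gamma> (t, x) p * indicator {t - \<delta>..} (fst p) \<partial>lborel) \<le> C * \<delta> powr (1 - \<gamma> / 2)"
    if "\<delta> \<ge> 0" for t \<delta> and x :: 'a
    using C(2)[OF that, of t x] C(1)
    by (intro integral_real_bounded) (auto simp: ennreal_mult' ennreal_indicator)
  with C(1) show ?thesis by blast
qed

text \<open>The exponent \<open>1 - \<gamma> / 2\<close> is positive, so the spatial decay bound at
  time \<open>t - s\<close> is largest at \<open>T\<close>. This makes the decay uniform over all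
  times up to \<open>T\<close>, as continuity in the supremum norm will require.\<close>

lemma integral_duhamel_kernel_decay:
  assumes "0 \<le> \<gamma>" "\<gamma> < min 2 (real DIM('a))"
  shows "\<exists>C\<ge>0. \<forall>T\<ge>0. \<forall>t\<le>T. \<forall>R>0. \<forall>x::'a::euclidean_space. 2 * R \<le> norm x \<longrightarrow>
    (\<integral>p. duhamel_kernel \<gamma> (t, x) p \<partial>lborel) \<le> (R powr - \<gamma> + C * T powr (1 - \<gamma> / 2) / R\<^sup>2) * T"
proof -
  obtain C where C: "C \<ge> 0" "\<And>t R (x::'a). t > 0 \<Longrightarrow> R > 0 \<Longrightarrow> 2 * R \<le> norm x \<Longrightarrow>
      (\<integral>\<^sup>+y. ennreal (heat_kernel t (x - y) * norm y powr - \<gamma>) \<partial>lborel)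
        \<le> ennreal (R powr - \<gamma> + C * t powr (1 - \<gamma> / 2) / R\<^sup>2)"
    using nn_integral_heat_kernel_weighted_decay[where 'a = 'a and \<gamma> = \<gamma>] assms by auto
  have "(\<integral>p. duhamel_kernel \<gamma> (t, x) p \<partial>lborel) \<le> (R powr - \<gamma> + C * T powr (1 - \<gamma> / 2) / R\<^sup>2) * T"
    if T: "0 \<le> T" "t \<le> T" and R: "R > 0" "2 * R \<le> norm x" for T t R and x :: 'a
  proof (rule integral_real_bounded)
    define c where "c = R powr - \<gamma> + C * T powr (1 - \<gamma> / 2) / R\<^sup>2"
    have c: "c \<ge> 0" using C(1) by (simp add: c_def)
    have "(\<integral>\<^sup>+p. ennreal (duhamel_kernel \<gamma> (t, x) p) \<partial>lborel) =
        (\<integral>\<^sup>+s. indicator {0<..<t} s *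
          (\<integral>\<^sup>+y. ennreal (heat_kernel (t - s) (x - y) * norm y powr - \<gamma>) \<partial>lborel) \<partial>lborel)"
      using nn_integral_duhamel_kernel[of "\<lambda>_. 1" \<gamma> t x] by simp
    also have "\<dots> \<le> (\<integral>\<^sup>+s. ennreal c * indicator {0..T} s \<partial>lborel)"
    proof (rule nn_integral_mono)
      fix s
      have "(\<integral>\<^sup>+y. ennreal (heat_kernel (t - s) (x - y) * norm y powr - \<gamma>) \<partial>lborel) \<le> ennreal c"
        if "0 < s" "s < t"
      proof -
        have "(t - s) powr (1 - \<gamma> / 2) \<le> T powr (1 - \<gamma> / 2)"
          using assms that T by (intro powr_mono2) auto
        then have "R powr - \<gamma> + C * (t - s) powr (1 - \<gamma> / 2) / R\<^sup>2 \<le> c"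
          unfolding c_def using C(1) by (intro add_left_mono divide_right_mono mult_left_mono) auto
        with C(2)[of "t - s" R x] R that show ?thesis
          by (auto intro: order_trans ennreal_leI)
      qed
      then show "indicator {0<..<t} s *
          (\<integral>\<^sup>+y. ennreal (heat_kernel (t - s) (x - y) * norm y powr - \<gamma>) \<partial>lborel)
        \<le> ennreal c * indicator {0..T} s"
        using T by (auto split: split_indicator)
    qed
    also have "\<dots> = ennreal (c * T)"
      using c T by (simp add: nn_integral_cmult_indicator ennreal_mult')
    finally show "(\<integral>\<^sup>+p. ennreal (duhamel_kernel \<gamma> (t, x) p) \<partial>lborel)
      \<le> ennreal ((R powr - \<gamma> + C * T powr (1 - \<gamma> / 2) / R\<^sup>2) * T)"
      by (simp add: c_def)
  qed (use C(1) that in simp)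
  with C(1) show ?thesis by blast
qed

text \<open>The kernel already confines the source time to the interval from 0 to
  \<open>fst z\<close>, so this is defined for all real times and equals 0 when \<open>fst z\<close>
  is not positive.\<close>

definition duhamel :: "real \<Rightarrow> (real \<times> 'a::euclidean_space \<Rightarrow> real) \<Rightarrow> real \<times> 'a \<Rightarrow> real" where
  "duhamel \<gamma> f z = (\<integral>p. duhamel_kernel \<gamma> z p * f p \<partial>lborel)"

text \<open>The source is bounded only at the times that the kernel sees, since the sources to come
  are bounded on bounded time intervals, with constants that depend on the interval.\<close>

lemma integrable_duhamel:
  fixes f :: "real \<times> 'a::euclidean_space \<Rightarrow> real"
  assumes "0 \<le> \<gamma>" "\<gamma> < min 2 (real DIM('a))"
    and [measurable]: "f \<in> borel_measurable borel"
    and "\<And>p. 0 < fst p \<Longrightarrow> fst p < fst z \<Longrightarrow> \<bar>f p\<bar> \<le> M"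
  shows "integrable lborel (\<lambda>p. duhamel_kernel \<gamma> z p * f p)"
proof (rule Bochner_Integration.integrable_bound)
  show "integrable lborel (\<lambda>p. duhamel_kernel \<gamma> z p * M)"
    by (intro integrable_mult_left integrable_duhamel_kernel assms)
  have "norm (duhamel_kernel \<gamma> z p * f p) \<le> norm (duhamel_kernel \<gamma> z p * M)" for p
    using assms(4)[of p] abs_ge_self[of M]
    by (cases "0 < fst p \<and> fst p < fst z") (auto simp: abs_mult duhamel_kernel_def intro!: mult_left_mono)
  then show "AE p in lborel. norm (duhamel_kernel \<gamma> z p * f p) \<le> norm (duhamel_kernel \<gamma> z p * M)"
    by simp
qed auto

lemma abs_duhamel_le:
  fixes f :: "real \<times> 'a::euclidean_space \<Rightarrow> real"
  assumes "0 \<le> \<gamma>" "\<gamma> < min 2 (real DIM('a))"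
    and "f \<in> borel_measurable borel"
    and M: "\<And>p. 0 < fst p \<Longrightarrow> fst p < fst z \<Longrightarrow> \<bar>f p\<bar> \<le> M"
  shows "\<bar>duhamel \<gamma> f z\<bar> \<le> M * (\<integral>p. duhamel_kernel \<gamma> z p \<partial>lborel)"
proof -
  have "\<bar>duhamel \<gamma> f z\<bar> \<le> (\<integral>p. \<bar>duhamel_kernel \<gamma> z p * f p\<bar> \<partial>lborel)"
    unfolding duhamel_def by (rule integral_abs_bound)
  also have "\<dots> \<le> (\<integral>p. M * duhamel_kernel \<gamma> z p \<partial>lborel)"
  proof (rule integral_mono)
    show "\<bar>duhamel_kernel \<gamma> z p * f p\<bar> \<le> M * duhamel_kernel \<gamma> z p" for p
      using M[of p] by (cases "0 < fst p \<and> fst p < fst z")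
        (auto simp: abs_mult duhamel_kernel_def mult.commute intro!: mult_right_mono)
  qed (intro integrable_abs integrable_duhamel[where M = M] integrable_mult_right integrable_duhamel_kernel assms; simp)+
  finally show ?thesis by simp
qed

section \<open>Continuity of the Duhamel term for measurable sources\<close>

text \<open>One fixed Gaussian dominates all kernels with bounded centre and with time bounded above
  and away from 0. The inequality \<open>|y|^2 \<le> 2 |x - y|^2 + 2 |x|^2\<close> is paid for by
  doubling the time \<open>T\<close> and by the exponential of \<open>B\<close>; the power of
  \<open>8 * pi * T\<close> undoes the normalisation at time \<open>2 * T\<close>.\<close>

lemma heat_kernel_le_heat_kernel:
  fixes x y :: "'a::euclidean_space"
  assumes "0 < \<delta>" "\<delta> \<le> s" "s \<le> T" "norm x \<le> B"
  shows "heat_kernel s (x - y) \<le> (4 * pi * \<delta>) powr (- real DIM('a) / 2) * exp (B\<^sup>2 / (4 * \<delta>)) *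
    (8 * pi * T) powr (real DIM('a) / 2) * heat_kernel (2 * T) y"
proof -
  have "(norm y)\<^sup>2 \<le> (norm (x - y) + norm x)\<^sup>2"
    using norm_triangle_ineq2[of y x] by (intro power_mono) (auto simp: norm_minus_commute)
  also have "\<dots> \<le> 2 * (norm (x - y))\<^sup>2 + 2 * (norm x)\<^sup>2"
    using sum_squares_bound[of "norm (x - y)" "norm x"] by (simp add: power2_sum)
  finally have "(norm y)\<^sup>2 / (8 * s) \<le> (2 * (norm (x - y))\<^sup>2 + 2 * (norm x)\<^sup>2) / (8 * s)"
    using assms by (intro divide_right_mono) auto
  also have "\<dots> = (norm (x - y))\<^sup>2 / (4 * s) + (norm x)\<^sup>2 / (4 * s)"
    by (simp add: add_divide_distrib)
  finally have 1: "(norm y)\<^sup>2 / (8 * s) \<le> (norm (x - y))\<^sup>2 / (4 * s) + (norm x)\<^sup>2 / (4 * s)" .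
  have 2: "(norm y)\<^sup>2 / (8 * T) \<le> (norm y)\<^sup>2 / (8 * s)"
    using assms by (intro divide_left_mono) auto
  have 3: "(norm x)\<^sup>2 / (4 * s) \<le> B\<^sup>2 / (4 * \<delta>)"
    using assms by (intro frac_le power_mono) auto
  have "exp (- (norm (x - y))\<^sup>2 / (4 * s)) \<le> exp (B\<^sup>2 / (4 * \<delta>) - (norm y)\<^sup>2 / (8 * T))"
    using 1 2 3 by simp
  also have "\<dots> = exp (B\<^sup>2 / (4 * \<delta>)) * exp (- (norm y)\<^sup>2 / (4 * (2 * T)))"
    by (simp flip: exp_add)
  finally have e: "exp (- (norm (x - y))\<^sup>2 / (4 * s)) \<le>
    exp (B\<^sup>2 / (4 * \<delta>)) * exp (- (norm y)\<^sup>2 / (4 * (2 * T)))" .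
  have "(4 * pi * s) powr (- real DIM('a) / 2) \<le> (4 * pi * \<delta>) powr (- real DIM('a) / 2)"
    using assms by (intro powr_mono2') auto
  with e have "heat_kernel s (x - y) \<le> (4 * pi * \<delta>) powr (- real DIM('a) / 2) *
      (exp (B\<^sup>2 / (4 * \<delta>)) * exp (- (norm y)\<^sup>2 / (4 * (2 * T))))"
    unfolding heat_kernel_def by (intro mult_mono) auto
  moreover have "exp (- (norm y)\<^sup>2 / (4 * (2 * T))) = (8 * pi * T) powr (real DIM('a) / 2) * heat_kernel (2 * T) y"
    using assms by (simp add: heat_kernel_def powr_minus field_simps)
  ultimately show ?thesis by (simp add: mult.assoc)
qed

text \<open>
  Cutting off the kernel at \<open>\<sigma> \<approx> t\<close> makes it continuous in \<open>z\<close> and dominated by an integrable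
  function; the removed part has mass \<open>O(\<delta>\<^bsup>1-\<gamma>/2\<^esup>)\<close>.
\<close>

definition cutoff :: "real \<Rightarrow> real \<Rightarrow> real" where
  "cutoff \<delta> s = max 0 (min 1 (s / \<delta> - 1))"

lemma cutoff_bounds [simp]: "0 \<le> cutoff \<delta> s" "cutoff \<delta> s \<le> 1"
  by (auto simp: cutoff_def)

lemma cutoff_eq_0: "\<delta> > 0 \<Longrightarrow> s \<le> \<delta> \<Longrightarrow> cutoff \<delta> s = 0"
  unfolding cutoff_def by (intro max_absorb1 min.coboundedI2) simp

lemma cutoff_eq_1: "\<delta> > 0 \<Longrightarrow> 2 * \<delta> \<le> s \<Longrightarrow> cutoff \<delta> s = 1"
  by (auto simp: cutoff_def field_simps min_def max_def)

lemma continuous_on_duhamel_kernel_cutoff: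
  fixes p :: "real \<times> 'a::euclidean_space"
  assumes "\<delta> > 0"
  shows "continuous_on UNIV (\<lambda>z. duhamel_kernel \<gamma> z p * cutoff \<delta> (fst z - fst p))"
proof (cases "fst p > 0")
  case True
  let ?f = "\<lambda>z. duhamel_kernel \<gamma> z p * cutoff \<delta> (fst z - fst p)"
  \<comment> \<open>Continuity in \<open>z\<close> can fail only as \<open>fst z\<close> decreases
    to \<open>fst p\<close>, and the cutoff vanishes around that time. On one open set the explicit
    formula holds, on the other the product is 0.\<close>
  have "continuous_on ({z. fst p < fst z} \<union> {z. fst z < fst p + \<delta>}) ?f"
  proof (rule continuous_on_open_Un)
    have "continuous_on {z. fst p < fst z} (\<lambda>z. heat_kernel (fst z - fst p) (snd z - snd p) *
        norm (snd p) powr - \<gamma> * cutoff \<delta> (fst z - fst p))"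
      unfolding heat_kernel_def cutoff_def using assms by (intro continuous_intros) auto
    then show "continuous_on {z. fst p < fst z} ?f"
      by (rule continuous_on_eq) (auto simp: duhamel_kernel_def True)
    show "continuous_on {z. fst z < fst p + \<delta>} ?f"
      by (rule continuous_on_eq[OF continuous_on_const[of _ 0]]) (auto simp: cutoff_eq_0 assms)
  qed (auto intro!: open_Collect_less continuous_intros)
  moreover have "{z::real \<times> 'a. fst p < fst z} \<union> {z. fst z < fst p + \<delta>} = UNIV"
    using assms by auto
  ultimately show ?thesis by simp
qed (simp add: duhamel_kernel_def)

lemma continuous_on_duhamel_cutoff:
  fixes f :: "real \<times> 'a::euclidean_space \<Rightarrow> real"
  assumes \<gamma>: "0 \<le> \<gamma>" "\<gamma> < min 2 (real DIM('a))"
    and [measurable]: "f \<in> borel_measurable borel"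
    and bound: "\<And>T. \<exists>M. \<forall>p. 0 < fst p \<longrightarrow> fst p < T \<longrightarrow> \<bar>f p\<bar> \<le> M"
    and "\<delta> > 0"
  shows "continuous_on UNIV (\<lambda>z. \<integral>p. duhamel_kernel \<gamma> z p * cutoff \<delta> (fst z - fst p) * f p \<partial>lborel)"
proof (rule continuous_on_sequentiallyI)
  fix X :: "nat \<Rightarrow> real \<times> 'a" and z assume X: "X \<longlonglongrightarrow> z"
  then have "Bseq X" by (intro convergent_imp_Bseq convergentI)
  then obtain B where B: "\<And>n. norm (X n) \<le> B" "B > 0" by (auto simp: Bseq_def)
  have B': "fst (X n) \<le> B" "norm (snd (X n)) \<le> B" for n
    using B(1)[of n] norm_fst_le[of "fst (X n)" "snd (X n)"] norm_snd_le[of "snd (X n)" "fst (X n)"] abs_ge_self[of "fst (X n)"] by auto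
  obtain M where M: "\<And>p. 0 < fst p \<Longrightarrow> fst p < B \<Longrightarrow> \<bar>f p\<bar> \<le> M"
    using bound[of B] by blast
  define K where "K = (4 * pi * \<delta>) powr (- real DIM('a) / 2) * exp (B\<^sup>2 / (4 * \<delta>)) *
    (8 * pi * B) powr (real DIM('a) / 2)"
  \<comment> \<open>A convergent sequence stays within one bound \<open>B\<close> for both times and
    positions, so the Gaussian comparison with \<open>T = B\<close> gives a single dominating
    function. It is integrable because the weighted Gaussian at time \<open>2 * B\<close> is and the
    time interval is finite.\<close>
  define D where "D p = indicator {0<..<B} (fst p) *
    (K * \<bar>M\<bar> * (heat_kernel (2 * B) (snd p) * norm (snd p) powr - \<gamma>))" for p :: "real \<times> 'a"
  have "K \<ge> 0" by (simp add: K_def)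
  have [measurable]: "D \<in> borel_measurable borel"
    unfolding D_def[abs_def] by measurable
  have "integrable lborel D"
  proof (rule integrableI_nonneg)
    obtain C where C: "\<And>t (x::'a). t > 0 \<Longrightarrow>
        (\<integral>\<^sup>+y. ennreal (heat_kernel t (x - y) * norm y powr - \<gamma>) \<partial>lborel) \<le> ennreal (C * t powr (- \<gamma> / 2))"
      using nn_integral_heat_kernel_weighted[where 'a = 'a and \<gamma> = \<gamma>] \<gamma> by auto
    have "heat_kernel t (0 - y) = heat_kernel t (y :: 'a)" for t y
      by (simp add: heat_kernel_def)
    then have fin: "(\<integral>\<^sup>+y. ennreal (heat_kernel (2 * B) y * norm (y::'a) powr - \<gamma>) \<partial>lborel) < \<infinity>"
      using C[of "2 * B" 0] B(2) by (auto intro: le_less_trans)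
    have "(\<integral>\<^sup>+p. ennreal (D p) \<partial>lborel) = (\<integral>\<^sup>+s. \<integral>\<^sup>+y. ennreal (D (s, y)) \<partial>lborel \<partial>lborel)"
      by (rule nn_integral_lborel_pair) measurable
    also have "\<dots> = (\<integral>\<^sup>+s. \<integral>\<^sup>+y. (ennreal (K * \<bar>M\<bar>) * indicator {0<..<B} s) *
        ennreal (heat_kernel (2 * B) y * norm (y::'a) powr - \<gamma>) \<partial>lborel \<partial>lborel)"
      using \<open>K \<ge> 0\<close>
      by (intro nn_integral_cong) (simp add: D_def ennreal_mult'[symmetric] split: split_indicator)
    also have "\<dots> = (\<integral>\<^sup>+s. (ennreal (K * \<bar>M\<bar>) * indicator {0<..<B} s) *
        (\<integral>\<^sup>+y. ennreal (heat_kernel (2 * B) y * norm (y::'a) powr - \<gamma>) \<partial>lborel) \<partial>lborel)"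
      by (intro nn_integral_cong nn_integral_cmult) measurable
    also have "\<dots> = (ennreal (K * \<bar>M\<bar>) * ennreal B) *
        (\<integral>\<^sup>+y. ennreal (heat_kernel (2 * B) y * norm (y::'a) powr - \<gamma>) \<partial>lborel)"
      using B(2) by (simp add: nn_integral_multc nn_integral_cmult)
    also have "\<dots> < \<infinity>"
      using fin by (simp add: ennreal_mult_less_top flip: ennreal_mult'')
    finally show "(\<integral>\<^sup>+p. ennreal (D p) \<partial>lborel) < \<infinity>" .
  qed (auto simp: D_def \<open>K \<ge> 0\<close>)
  have dom: "norm (duhamel_kernel \<gamma> (X n) p * cutoff \<delta> (fst (X n) - fst p) * f p) \<le> D p" for n p
  proof (cases "0 < fst p \<and> \<delta> \<le> fst (X n) - fst p")
    case True
    then have p: "0 < fst p" "fst p < B" "fst (X n) - fst p \<le> B" "fst p < fst (X n)"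
      using B'(1)[of n] \<open>\<delta> > 0\<close> by linarith+
    have "heat_kernel (fst (X n) - fst p) (snd (X n) - snd p) \<le> K * heat_kernel (2 * B) (snd p)"
      unfolding K_def using True p B' \<open>\<delta> > 0\<close> by (intro heat_kernel_le_heat_kernel) auto
    then have "duhamel_kernel \<gamma> (X n) p \<le> K * heat_kernel (2 * B) (snd p) * norm (snd p) powr - \<gamma>"
      using p by (simp add: duhamel_kernel_def mult_right_mono)
    moreover have "\<bar>f p\<bar> \<le> \<bar>M\<bar>" using M[of p] p by linarith
    ultimately have "duhamel_kernel \<gamma> (X n) p * cutoff \<delta> (fst (X n) - fst p) * \<bar>f p\<bar>
        \<le> (K * heat_kernel (2 * B) (snd p) * norm (snd p) powr - \<gamma>) * 1 * \<bar>M\<bar>"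
      using \<open>K \<ge> 0\<close> by (intro mult_mono) auto
    then show ?thesis using p by (simp add: D_def abs_mult mult_ac)
  next
    case False
    then have "duhamel_kernel \<gamma> (X n) p * cutoff \<delta> (fst (X n) - fst p) = 0"
      using \<open>\<delta> > 0\<close> by (auto simp: duhamel_kernel_def cutoff_eq_0)
    moreover have "0 \<le> D p" using \<open>K \<ge> 0\<close> by (simp add: D_def)
    ultimately show ?thesis by auto
  qed
  have [measurable]: "cutoff \<delta> \<in> borel_measurable borel"
    unfolding cutoff_def[abs_def] by measurable
  show "(\<lambda>n. \<integral>p. duhamel_kernel \<gamma> (X n) p * cutoff \<delta> (fst (X n) - fst p) * f p \<partial>lborel)
      \<longlonglongrightarrow> (\<integral>p. duhamel_kernel \<gamma> z p * cutoff \<delta> (fst z - fst p) * f p \<partial>lborel)"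
  proof (rule integral_dominated_convergence[OF _ _ \<open>integrable lborel D\<close>])
    have "(\<lambda>n. duhamel_kernel \<gamma> (X n) p * cutoff \<delta> (fst (X n) - fst p) * f p) \<longlonglongrightarrow>
        duhamel_kernel \<gamma> z p * cutoff \<delta> (fst z - fst p) * f p" for p
      using continuous_on_tendsto_compose[OF continuous_on_duhamel_kernel_cutoff[OF \<open>\<delta> > 0\<close>, of \<gamma> p] X]
      by (auto intro: tendsto_mult)
    then show "AE p in lborel. (\<lambda>n. duhamel_kernel \<gamma> (X n) p * cutoff \<delta> (fst (X n) - fst p) * f p) \<longlonglongrightarrow>
        duhamel_kernel \<gamma> z p * cutoff \<delta> (fst z - fst p) * f p" by simp
  qed (use dom in simp_all)
qed

text \<open>As \<open>\<delta>\<close> tends to 0, the continuous functions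
  \<open>W \<delta>\<close> approach the Duhamel term uniformly on times bounded above, so
  continuity passes to the limit. All regularity comes from the kernel, none from
  \<open>f\<close>.\<close>

lemma continuous_on_duhamel:
  fixes f :: "real \<times> 'a::euclidean_space \<Rightarrow> real"
  assumes \<gamma>: "0 \<le> \<gamma>" "\<gamma> < min 2 (real DIM('a))"
    and [measurable]: "f \<in> borel_measurable borel"
    and bound: "\<And>T. \<exists>M. \<forall>p. 0 < fst p \<longrightarrow> fst p < T \<longrightarrow> \<bar>f p\<bar> \<le> M"
  shows "continuous_on UNIV (duhamel \<gamma> f)"
proof -
  define W where "W \<delta> z = (\<integral>p. duhamel_kernel \<gamma> z p * cutoff \<delta> (fst z - fst p) * f p \<partial>lborel)" for \<delta> z
  obtain C where C: "C \<ge> 0" "\<And>t (x::'a) \<delta>. \<delta> \<ge> 0 \<Longrightarrow>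
      (\<integral>p. duhamel_kernel \<gamma> (t, x) p * indicator {t - \<delta>..} (fst p) \<partial>lborel) \<le> C * \<delta> powr (1 - \<gamma> / 2)"
    using integral_duhamel_kernel_le[OF \<gamma>] by blast
  \<comment> \<open>The cutoff equals 1 once the elapsed time reaches \<open>2 * \<delta>\<close>,
    so the two integrands differ only in the last window of that length.\<close>
  have near: "\<bar>duhamel \<gamma> f z - W \<delta> z\<bar> \<le> M * (C * (2 * \<delta>) powr (1 - \<gamma> / 2))"
    if M: "\<And>p. 0 < fst p \<Longrightarrow> fst p < T \<Longrightarrow> \<bar>f p\<bar> \<le> M" "M \<ge> 0" and "fst z \<le> T" "\<delta> > 0" for M T z \<delta>
  proof -
    have [measurable]: "cutoff \<delta> \<in> borel_measurable borel"
      unfolding cutoff_def[abs_def] by measurable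
    have int: "integrable lborel (\<lambda>p. duhamel_kernel \<gamma> z p * f p)"
      using that by (intro integrable_duhamel[where M = M] \<gamma>) auto
    have int': "integrable lborel (\<lambda>p. duhamel_kernel \<gamma> z p * cutoff \<delta> (fst z - fst p) * f p)"
      by (rule Bochner_Integration.integrable_bound[OF int])
        (auto simp: abs_mult mult_left_le intro!: mult_right_mono)
    have ind: "integrable lborel (\<lambda>p. duhamel_kernel \<gamma> z p * indicator {fst z - 2 * \<delta>..} (fst p))"
      by (rule Bochner_Integration.integrable_bound[OF integrable_duhamel_kernel[OF \<gamma>, of z]])
        (auto split: split_indicator)
    have "duhamel \<gamma> f z - W \<delta> z =
        (\<integral>p. duhamel_kernel \<gamma> z p * f p - duhamel_kernel \<gamma> z p * cutoff \<delta> (fst z - fst p) * f p \<partial>lborel)"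
      unfolding duhamel_def W_def using int int' by simp
    also have "\<bar>\<dots>\<bar> \<le> (\<integral>p. \<bar>duhamel_kernel \<gamma> z p * f p - duhamel_kernel \<gamma> z p * cutoff \<delta> (fst z - fst p) * f p\<bar> \<partial>lborel)"
      by (rule integral_abs_bound)
    also have "\<dots> \<le> (\<integral>p. M * (duhamel_kernel \<gamma> z p * indicator {fst z - 2 * \<delta>..} (fst p)) \<partial>lborel)"
    proof (rule integral_mono)
      fix p
      show "\<bar>duhamel_kernel \<gamma> z p * f p - duhamel_kernel \<gamma> z p * cutoff \<delta> (fst z - fst p) * f p\<bar>
        \<le> M * (duhamel_kernel \<gamma> z p * indicator {fst z - 2 * \<delta>..} (fst p))"
      proof (cases "0 < fst p \<and> fst p < fst z \<and> fst z - 2 * \<delta> \<le> fst p")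
        case True
        have "duhamel_kernel \<gamma> z p * f p - duhamel_kernel \<gamma> z p * cutoff \<delta> (fst z - fst p) * f p
          = duhamel_kernel \<gamma> z p * (1 - cutoff \<delta> (fst z - fst p)) * f p"
          by (simp add: algebra_simps)
        then have "\<bar>duhamel_kernel \<gamma> z p * f p - duhamel_kernel \<gamma> z p * cutoff \<delta> (fst z - fst p) * f p\<bar>
          = duhamel_kernel \<gamma> z p * (1 - cutoff \<delta> (fst z - fst p)) * \<bar>f p\<bar>"
          by (simp add: abs_mult)
        also have "\<dots> \<le> duhamel_kernel \<gamma> z p * 1 * M"
          using M(1)[of p] True that by (intro mult_mono) auto
        finally show ?thesis using True by (simp add: mult.commute)
      next
        case False
        then have "duhamel_kernel \<gamma> z p = 0 \<or> cutoff \<delta> (fst z - fst p) = 1"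
          using \<open>\<delta> > 0\<close> by (auto simp: duhamel_kernel_def intro!: cutoff_eq_1)
        then show ?thesis using \<open>M \<ge> 0\<close> by auto
      qed
    qed (use int int' ind in auto)
    also have "\<dots> \<le> M * (C * (2 * \<delta>) powr (1 - \<gamma> / 2))"
      using C(2)[of "2 * \<delta>" "fst z" "snd z"] that by (simp add: mult_left_mono)
    finally show ?thesis .
  qed
  show ?thesis
  proof (rule continuous_on_sequentiallyI)
    fix X :: "nat \<Rightarrow> real \<times> 'a" and z assume X: "X \<longlonglongrightarrow> z"
    then have "Bseq X" by (intro convergent_imp_Bseq convergentI)
    then obtain B where B: "\<And>n. norm (X n) \<le> B" by (auto simp: Bseq_def)
    have XB: "fst (X n) \<le> B" for n
      using B[of n] norm_fst_le[of "fst (X n)" "snd (X n)"] abs_ge_self[of "fst (X n)"] by auto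
    have zB: "fst z \<le> B"
      using XB by (intro LIMSEQ_le_const2[OF tendsto_fst[OF X]]) auto
    obtain M0 where M0: "\<And>p. 0 < fst p \<Longrightarrow> fst p < B \<Longrightarrow> \<bar>f p\<bar> \<le> M0"
      using bound[of B] by blast
    define M where "M = max 0 M0"
    have M: "\<And>p. 0 < fst p \<Longrightarrow> fst p < B \<Longrightarrow> \<bar>f p\<bar> \<le> M" "M \<ge> 0"
      using M0 unfolding M_def by (meson max.coboundedI2, simp)
    show "(\<lambda>n. duhamel \<gamma> f (X n)) \<longlonglongrightarrow> duhamel \<gamma> f z"
    proof (rule tendstoI)
      fix e :: real assume "e > 0"
      have "((\<lambda>\<delta>. M * (C * (2 * \<delta>) powr (1 - \<gamma> / 2))) \<longlongrightarrow> M * (C * (2 * 0) powr (1 - \<gamma> / 2))) (at_right 0)"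
        using \<gamma> by (intro tendsto_intros) (auto simp: eventually_at_filter)
      then have "\<forall>\<^sub>F \<delta> in at_right 0. M * (C * (2 * \<delta>) powr (1 - \<gamma> / 2)) < e / 3"
        using \<open>e > 0\<close> by (intro order_tendstoD(2)) auto
      then have "\<forall>\<^sub>F \<delta> in at_right 0. M * (C * (2 * \<delta>) powr (1 - \<gamma> / 2)) < e / 3 \<and> \<delta> > 0"
        by (intro eventually_conj) (auto simp: eventually_at_filter)
      from eventually_happens[OF this] obtain \<delta> where
        \<delta>: "M * (C * (2 * \<delta>) powr (1 - \<gamma> / 2)) < e / 3" "\<delta> > 0"
        by (auto simp: trivial_limit_at_right_real)
      have "(\<lambda>n. W \<delta> (X n)) \<longlonglongrightarrow> W \<delta> z"
        unfolding W_def
        using continuous_on_tendsto_compose[OF continuous_on_duhamel_cutoff[OF \<gamma> assms(3) bound \<delta>(2)] X]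
        by simp
      then have "\<forall>\<^sub>F n in sequentially. dist (W \<delta> (X n)) (W \<delta> z) < e / 3"
        using \<open>e > 0\<close> by (intro tendstoD) auto
      then show "\<forall>\<^sub>F n in sequentially. dist (duhamel \<gamma> f (X n)) (duhamel \<gamma> f z) < e"
      proof eventually_elim
        case (elim n)
        have "\<bar>duhamel \<gamma> f (X n) - W \<delta> (X n)\<bar> < e / 3" "\<bar>duhamel \<gamma> f z - W \<delta> z\<bar> < e / 3"
          using near[OF M XB \<delta>(2), of n] near[OF M zB \<delta>(2)] \<delta>(1) by auto
        then show ?case using elim unfolding dist_real_def by linarith
      qed
    qed
  qed
qed

section \<open>The heat semigroup and paths in \<open>C\<^sub>0\<close>\<close>

text \<open>
  The substitution \<open>y = x - sqrt t z\<close> turns the heat semigroup into an integral that is continuous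
  up to \<open>t = 0\<close>; negative times are sent to \<open>0\<close>.
\<close>

definition heat_flow :: "('a::euclidean_space \<Rightarrow> real) \<Rightarrow> real \<times> 'a \<Rightarrow> real" where
  "heat_flow \<phi> p = (\<integral>z. heat_kernel 1 z * \<phi> (snd p - sqrt (max 0 (fst p)) *\<^sub>R z) \<partial>lborel)"

lemma has_bochner_integral_heat_kernel:
  "has_bochner_integral lborel (heat_kernel 1 :: 'a::euclidean_space \<Rightarrow> real) 1"
proof (rule has_bochner_integral_nn_integral)
  have "heat_kernel 1 (0 - z) = heat_kernel 1 (z :: 'a)" for z
    by (simp add: heat_kernel_def)
  then show "(\<integral>\<^sup>+z. ennreal (heat_kernel 1 (z :: 'a)) \<partial>lborel) = ennreal 1"
    using nn_integral_heat_kernel[of 1 "0 :: 'a"] by simp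
qed auto

lemmas integrable_heat_kernel = has_bochner_integral_heat_kernel[unfolded has_bochner_integral_iff, THEN conjunct1]
  and integral_heat_kernel = has_bochner_integral_heat_kernel[unfolded has_bochner_integral_iff, THEN conjunct2]

lemma lebesgue_integral_affine:
  fixes g :: "'a::euclidean_space \<Rightarrow> real"
  assumes [measurable]: "g \<in> borel_measurable borel" and "c \<noteq> 0"
  shows "(\<integral>y. g y \<partial>lborel) = \<bar>c\<bar> ^ DIM('a) * (\<integral>z. g (x + c *\<^sub>R z) \<partial>lborel)"
proof -
  have "(\<integral>y. g y \<partial>lborel) = (\<integral>y. g y \<partial>density (distr lborel borel (\<lambda>z. x + c *\<^sub>R z)) (\<lambda>_. ennreal (\<bar>c\<bar> ^ DIM('a))))"
    using lborel_affine[OF assms(2), of x] by simp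
  also have "\<dots> = \<bar>c\<bar> ^ DIM('a) * (\<integral>z. g (x + c *\<^sub>R z) \<partial>lborel)"
    by (simp add: integral_density integral_distr)
  finally show ?thesis .
qed

lemma heat_semigroup_eq_heat_flow:
  fixes x :: "real ^ 'n"
  assumes "t \<ge> 0" and [measurable]: "\<phi> \<in> borel_measurable borel"
  shows "heat_semigroup t \<phi> x = heat_flow \<phi> (t, x)"
proof (cases "t = 0")
  \<comment> \<open>At time 0 the argument of \<open>\<phi>\<close> no longer depends on the
    integration variable, and the unit mass of the kernel gives the identity.\<close>
  case True
  then show ?thesis
    by (simp add: heat_semigroup_def heat_flow_def integral_heat_kernel)
next
  case False
  with assms(1) have t: "t > 0" by simp
  let ?N = "real CARD('n)"
  have "(LINT y|lborel. exp (- (norm (x - y))\<^sup>2 / (4 * t)) * \<phi> y) =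
      \<bar>- sqrt t\<bar> ^ DIM(real ^ 'n) * (LINT z|lborel. exp (- (norm (x - (x + (- sqrt t) *\<^sub>R z)))\<^sup>2 / (4 * t)) * \<phi> (x + (- sqrt t) *\<^sub>R z))"
    using t by (subst lebesgue_integral_affine[where c = "- sqrt t" and x = x]) auto
  also have "\<dots> = t powr (?N / 2) * (LINT z|lborel. exp (- (norm z)\<^sup>2 / 4) * \<phi> (x - sqrt t *\<^sub>R z))"
  proof -
    have "\<bar>- sqrt t\<bar> ^ DIM(real ^ 'n) = t powr (?N / 2)"
      using t by (simp add: powr_half_sqrt[symmetric] powr_power)
    moreover have "exp (- (norm (x - (x + (- sqrt t) *\<^sub>R z)))\<^sup>2 / (4 * t)) = exp (- (norm z)\<^sup>2 / 4)" for z
      using t by (simp add: power_mult_distrib)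
    moreover have "x + (- sqrt t) *\<^sub>R z = x - sqrt t *\<^sub>R z" for z by simp
    ultimately show ?thesis by (simp only:)
  qed
  finally have "heat_semigroup t \<phi> x = ((4 * pi * t) powr (- ?N / 2) * t powr (?N / 2)) *
      (LINT z|lborel. exp (- (norm z)\<^sup>2 / 4) * \<phi> (x - sqrt t *\<^sub>R z))"
    using False by (simp add: heat_semigroup_def)
  also have "(4 * pi * t) powr (- ?N / 2) * t powr (?N / 2) = (4 * pi) powr (- ?N / 2)"
    using t by (simp add: powr_mult powr_minus)
  also have "(4 * pi) powr (- ?N / 2) * (LINT z|lborel. exp (- (norm z)\<^sup>2 / 4) * \<phi> (x - sqrt t *\<^sub>R z)) =
      heat_flow \<phi> (t, x)"
    using t by (simp add: heat_flow_def heat_kernel_def mult.assoc)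
  finally show ?thesis .
qed

text \<open>The limit \<open>g\<close> is left free so that one dominated convergence serves twice:
  with a shifted copy of \<open>\<phi>\<close> for continuity, and with 0 for decay.\<close>

lemma heat_flow_tendsto:
  fixes X :: "nat \<Rightarrow> real \<times> 'a::euclidean_space"
  assumes "\<phi> \<in> borel_measurable borel" "\<And>x. \<bar>\<phi> x\<bar> \<le> B"
    and "g \<in> borel_measurable borel"
    and "\<And>z. (\<lambda>n. \<phi> (snd (X n) - sqrt (max 0 (fst (X n))) *\<^sub>R z)) \<longlonglongrightarrow> g z"
  shows "(\<lambda>n. heat_flow \<phi> (X n)) \<longlonglongrightarrow> (\<integral>z. heat_kernel 1 z * g z \<partial>lborel)"
  unfolding heat_flow_def
proof (rule integral_dominated_convergence)
  show "integrable lborel (\<lambda>z::'a. B * heat_kernel 1 z)"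
    by (intro integrable_mult_right integrable_heat_kernel)
  show "AE z in lborel. norm (heat_kernel 1 z * \<phi> (snd (X n) - sqrt (max 0 (fst (X n))) *\<^sub>R z)) \<le> B * heat_kernel 1 z" for n
  proof (rule AE_I2)
    fix z
    have "\<bar>\<phi> (snd (X n) - sqrt (max 0 (fst (X n))) *\<^sub>R z)\<bar> * heat_kernel 1 z \<le> B * heat_kernel 1 z"
      by (intro mult_right_mono assms heat_kernel_nonneg)
    then show "norm (heat_kernel 1 z * \<phi> (snd (X n) - sqrt (max 0 (fst (X n))) *\<^sub>R z)) \<le> B * heat_kernel 1 z"
      by (simp add: abs_mult mult.commute)
  qed
qed (use assms in \<open>auto intro!: tendsto_mult AE_I2\<close>)

lemma continuous_on_heat_flow:
  fixes \<phi> :: "'a::euclidean_space \<Rightarrow> real"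
  assumes "continuous_on UNIV \<phi>" "\<And>x. \<bar>\<phi> x\<bar> \<le> B"
  shows "continuous_on UNIV (heat_flow \<phi>)"
proof (rule continuous_on_sequentiallyI)
  fix X :: "nat \<Rightarrow> real \<times> 'a" and p assume X: "X \<longlonglongrightarrow> p"
  have [measurable]: "\<phi> \<in> borel_measurable borel"
    using assms(1) by (rule borel_measurable_continuous_onI)
  show "(\<lambda>n. heat_flow \<phi> (X n)) \<longlonglongrightarrow> heat_flow \<phi> p"
    unfolding heat_flow_def[of \<phi> p]
    by (rule heat_flow_tendsto[of _ B])
      (auto intro!: continuous_on_tendsto_compose[OF assms(1)] tendsto_intros X assms)
qed

lemma heat_flow_bounds:
  fixes \<phi> :: "'a::euclidean_space \<Rightarrow> real"
  assumes [measurable]: "\<phi> \<in> borel_measurable borel" and "\<And>x. 0 \<le> \<phi> x" "\<And>x. \<phi> x \<le> B"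
  shows "0 \<le> heat_flow \<phi> p" "heat_flow \<phi> p \<le> B"
proof -
  show "0 \<le> heat_flow \<phi> p"
    unfolding heat_flow_def using assms(2) by (intro integral_nonneg_AE) auto
  have le: "heat_kernel 1 z * \<phi> (snd p - sqrt (max 0 (fst p)) *\<^sub>R z) \<le> B * heat_kernel 1 z" for z
    by (subst mult.commute) (intro mult_right_mono assms heat_kernel_nonneg)
  have "integrable lborel (\<lambda>z. heat_kernel 1 z * \<phi> (snd p - sqrt (max 0 (fst p)) *\<^sub>R z))"
    by (rule Bochner_Integration.integrable_bound[OF integrable_mult_right[OF integrable_heat_kernel, of B]])
      (use le assms(2) in \<open>auto intro!: AE_I2 order_trans[OF _ abs_ge_self]\<close>)
  then have "heat_flow \<phi> p \<le> (\<integral>z. B * heat_kernel 1 (z::'a) \<partial>lborel)"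
    unfolding heat_flow_def by (intro integral_mono integrable_mult_right integrable_heat_kernel le)
  then show "heat_flow \<phi> p \<le> B" by (simp add: integral_heat_kernel)
qed

text \<open>Otherwise the flow stays at least \<open>e\<close> in absolute value along points
  escaping to infinity. For each fixed \<open>z\<close> the shift is at most
  \<open>sqrt (max 0 T) * norm z\<close>, so the arguments of \<open>\<phi>\<close> escape as well,
  and dominated convergence forces the limit 0.\<close>

lemma heat_flow_decay:
  fixes \<phi> :: "'a::euclidean_space \<Rightarrow> real"
  assumes cont: "continuous_on UNIV \<phi>" and B: "\<And>x. \<bar>\<phi> x\<bar> \<le> B"
    and van: "\<And>e. e > 0 \<Longrightarrow> \<exists>R. \<forall>x. R \<le> norm x \<longrightarrow> \<bar>\<phi> x\<bar> < e"
    and "e > 0"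
  shows "\<exists>R. \<forall>t\<le>T. \<forall>x. R \<le> norm x \<longrightarrow> \<bar>heat_flow \<phi> (t, x)\<bar> < e"
proof (rule ccontr)
  assume "\<not> ?thesis"
  then have "\<forall>n::nat. \<exists>t x. t \<le> T \<and> real n \<le> norm x \<and> \<bar>heat_flow \<phi> (t, x)\<bar> \<ge> e"
    by (meson not_less)
  then obtain t x where tx: "\<And>n::nat. t n \<le> T" "\<And>n. real n \<le> norm (x n)" "\<And>n. \<bar>heat_flow \<phi> (t n, x n)\<bar> \<ge> e"
    by metis
  have [measurable]: "\<phi> \<in> borel_measurable borel"
    using cont by (rule borel_measurable_continuous_onI)
  have "(\<lambda>n. heat_flow \<phi> (t n, x n)) \<longlonglongrightarrow> (\<integral>z. heat_kernel 1 (z::'a) * 0 \<partial>lborel)"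
  proof (rule heat_flow_tendsto)
    fix z :: 'a
    show "(\<lambda>n. \<phi> (snd (t n, x n) - sqrt (max 0 (fst (t n, x n))) *\<^sub>R z)) \<longlonglongrightarrow> 0"
    proof (rule LIMSEQ_I)
      fix r :: real assume "r > 0"
      then obtain R where R: "\<And>x. R \<le> norm x \<Longrightarrow> \<bar>\<phi> x\<bar> < r" using van by blast
      obtain n0 where n0: "R + sqrt (max 0 T) * norm z \<le> real n0" using real_arch_simple by blast
      have "norm (\<phi> (x n - sqrt (max 0 (t n)) *\<^sub>R z) - 0) < r" if "n \<ge> n0" for n
      proof -
        have "norm (sqrt (max 0 (t n)) *\<^sub>R z) \<le> sqrt (max 0 T) * norm z"
          using tx(1)[of n] by (auto intro!: mult_right_mono)
        then have "R \<le> norm (x n - sqrt (max 0 (t n)) *\<^sub>R z)"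
          using n0 tx(2)[of n] that norm_triangle_ineq2[of "x n" "sqrt (max 0 (t n)) *\<^sub>R z"] by linarith
        then show ?thesis using R by simp
      qed
      then show "\<exists>n0. \<forall>n\<ge>n0. norm (\<phi> (snd (t n, x n) - sqrt (max 0 (fst (t n, x n))) *\<^sub>R z) - 0) < r"
        by auto
    qed
  qed (use B in auto)
  then have "(\<lambda>n. heat_flow \<phi> (t n, x n)) \<longlonglongrightarrow> 0" by simp
  then obtain n where "norm (heat_flow \<phi> (t n, x n) - 0) < e"
    using LIMSEQ_D[OF _ \<open>e > 0\<close>] by blast
  with tx(3)[of n] show False by simp
qed

section \<open>From functions on space-time to continuous paths in \<open>C0\<close>\<close>

text \<open>Joint continuity alone gives convergence only on compact sets of space. Decay uniform in
  time handles the outside of a large ball, and uniform continuity on a compact cylinder handles the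
  inside; together they control the supremum norm.\<close>

lemma continuous_path_in_C0:
  fixes U :: "real \<times> (real ^ 'n) \<Rightarrow> real"
  assumes cont: "continuous_on UNIV U"
    and van: "\<And>T e. e > 0 \<Longrightarrow> \<exists>R. \<forall>t\<le>T. \<forall>x. R \<le> norm x \<longrightarrow> \<bar>U (t, x)\<bar> < e"
  shows "\<exists>u. continuous_on UNIV u \<and> (\<forall>t. u t \<in> C0 \<and> (\<forall>x. apply_bcontfun (u t) x = U (t, x)))"
proof -
  define u where "u t = Bcontfun (\<lambda>x. U (t, x))" for t
  have "(\<lambda>x. U (t, x)) \<in> bcontfun" for t
  proof -
    have c: "continuous_on A (\<lambda>x. U (t, x))" for A
      by (rule continuous_on_compose2[OF cont]) (auto intro!: continuous_intros)
    obtain R where R: "\<And>x. R \<le> norm x \<Longrightarrow> \<bar>U (t, x)\<bar> < 1" using van[of 1 t] by auto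
    have "compact ((\<lambda>x. U (t, x)) ` cball 0 R)"
      by (intro compact_continuous_image c compact_cball)
    \<comment> \<open>Here \<open>ball 0 1\<close> is a set of real values: it contains those that
      \<open>U\<close> takes outside \<open>cball 0 R\<close>.\<close>
    then have "bounded ((\<lambda>x. U (t, x)) ` cball 0 R \<union> ball 0 1)"
      by (auto dest: compact_imp_bounded)
    moreover have "range (\<lambda>x. U (t, x)) \<subseteq> (\<lambda>x. U (t, x)) ` cball 0 R \<union> ball 0 1"
      using R by (force simp: not_le[symmetric])
    ultimately have "bounded (range (\<lambda>x. U (t, x)))" by (rule bounded_subset)
    then show ?thesis
      using c by (simp add: bcontfun_def)
  qed
  then have u: "apply_bcontfun (u t) x = U (t, x)" for t x
    by (simp add: u_def Bcontfun_inverse)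
  moreover have "u t \<in> C0" for t
    unfolding C0_iff_vanishes_at_infinity u using van[of _ t] by blast
  moreover have "continuous_on UNIV u"
    unfolding continuous_on_iff
  proof (intro ballI allI impI)
    fix t e :: real assume "e > 0"
    then obtain R where R: "\<And>s x. s \<le> t + 1 \<Longrightarrow> R \<le> norm x \<Longrightarrow> \<bar>U (s, x)\<bar> < e / 4"
      using van[of "e / 4" "t + 1"] by auto
    have "uniformly_continuous_on ({t - 1..t + 1} \<times> cball 0 R) U"
      by (intro compact_uniformly_continuous continuous_on_subset[OF cont] compact_Times) auto
    then obtain d where d: "d > 0" "\<And>p p'. p \<in> {t - 1..t + 1} \<times> cball 0 R \<Longrightarrow>
        p' \<in> {t - 1..t + 1} \<times> cball 0 R \<Longrightarrow> dist p' p < d \<Longrightarrow> dist (U p') (U p) < e / 2"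
      unfolding uniformly_continuous_on_def using \<open>e > 0\<close> by (meson half_gt_zero)
    have "dist (u s) (u t) < e" if "dist s t < min 1 d" for s
    proof -
      have "dist (apply_bcontfun (u s) x) (apply_bcontfun (u t) x) \<le> e / 2" for x
      proof (cases "R \<le> norm x")
        case True
        moreover have "s \<le> t + 1" using that by (simp add: dist_real_def abs_less_iff)
        ultimately have "\<bar>U (s, x)\<bar> < e / 4" "\<bar>U (t, x)\<bar> < e / 4"
          by (intro R; simp)+
        then show ?thesis unfolding u dist_real_def by linarith
      next
        case False
        have "dist (U (s, x)) (U (t, x)) < e / 2"
        proof (rule d(2))
          show "(s, x) \<in> {t - 1..t + 1} \<times> cball 0 R" "(t, x) \<in> {t - 1..t + 1} \<times> cball 0 R"
            using that False by (auto simp: dist_real_def)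
          show "dist (s, x) (t, x) < d" using that by (simp add: dist_Pair_Pair)
        qed
        then show ?thesis unfolding u by simp
      qed
      then have "dist (u s) (u t) \<le> e / 2" by (rule dist_bound)
      with \<open>e > 0\<close> show ?thesis by simp
    qed
    then show "\<exists>d>0. \<forall>s\<in>UNIV. dist s t < d \<longrightarrow> dist (u s) (u t) < e"
      using d(1) by (intro exI[of _ "min 1 d"]) auto
  qed
  ultimately show ?thesis by blast
qed

section \<open>Existence of a mild solution\<close>

text \<open>The source is merely bounded, so the decay comes from the weight: strict positivity of
  \<open>\<gamma>\<close> makes \<open>R powr - \<gamma>\<close> tend to 0.\<close>

lemma duhamel_decay:
  fixes f :: "real \<times> 'a::euclidean_space \<Rightarrow> real"
  assumes \<gamma>: "0 < \<gamma>" "\<gamma> < min 2 (real DIM('a))"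
    and f: "f \<in> borel_measurable borel"
    and bound: "\<And>T. \<exists>M. \<forall>p. 0 < fst p \<longrightarrow> fst p < T \<longrightarrow> \<bar>f p\<bar> \<le> M"
    and "e > 0"
  shows "\<exists>R. \<forall>t\<le>T. \<forall>x. R \<le> norm x \<longrightarrow> \<bar>duhamel \<gamma> f (t, x)\<bar> < e"
proof -
  obtain C where C: "C \<ge> 0" "\<And>T t R (x::'a). T \<ge> 0 \<Longrightarrow> t \<le> T \<Longrightarrow> R > 0 \<Longrightarrow> 2 * R \<le> norm x \<Longrightarrow>
      (\<integral>p. duhamel_kernel \<gamma> (t, x) p \<partial>lborel) \<le> (R powr - \<gamma> + C * T powr (1 - \<gamma> / 2) / R\<^sup>2) * T"
    using integral_duhamel_kernel_decay[of \<gamma>, where 'a = 'a] \<gamma> by auto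
  define S where "S = max 0 T"
  obtain M0 where M0: "\<And>p. 0 < fst p \<Longrightarrow> fst p < S \<Longrightarrow> \<bar>f p\<bar> \<le> M0"
    using bound by blast
  \<comment> \<open>For \<open>S = 0\<close> the bound by \<open>M0\<close> is vacuous and
    \<open>M0\<close> may be negative, hence the maximum.\<close>
  define M where "M = max 0 M0"
  have "((\<lambda>R. M * ((R powr - \<gamma> + C * S powr (1 - \<gamma> / 2) * inverse (R\<^sup>2)) * S)) \<longlongrightarrow>
      M * ((0 + C * S powr (1 - \<gamma> / 2) * 0) * S)) at_top"
    by (intro tendsto_intros tendsto_neg_powr filterlim_ident tendsto_inverse_0_at_top
        filterlim_pow_at_top) (use \<gamma> in auto)
  then have "\<forall>\<^sub>F R in at_top. M * ((R powr - \<gamma> + C * S powr (1 - \<gamma> / 2) * inverse (R\<^sup>2)) * S) < e"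
    using \<open>e > 0\<close> by (intro order_tendstoD(2)) auto
  then have "\<forall>\<^sub>F R in at_top. M * ((R powr - \<gamma> + C * S powr (1 - \<gamma> / 2) * inverse (R\<^sup>2)) * S) < e \<and> R > 0"
    by (intro eventually_conj eventually_gt_at_top)
  then obtain R where R: "R > 0" "M * ((R powr - \<gamma> + C * S powr (1 - \<gamma> / 2) * inverse (R\<^sup>2)) * S) < e"
    by (auto simp: eventually_at_top_linorder)
  have "\<bar>duhamel \<gamma> f (t, x)\<bar> < e" if "t \<le> T" "2 * R \<le> norm x" for t x
  proof -
    have "\<bar>duhamel \<gamma> f (t, x)\<bar> \<le> M * (\<integral>p. duhamel_kernel \<gamma> (t, x) p \<partial>lborel)"
    proof (rule abs_duhamel_le)
      fix p :: "real \<times> 'a" assume "0 < fst p" "fst p < fst (t, x)"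
      then show "\<bar>f p\<bar> \<le> M" using M0[of p] that by (simp add: M_def S_def)
    qed (use \<gamma> f in auto)
    also have "\<dots> \<le> M * ((R powr - \<gamma> + C * S powr (1 - \<gamma> / 2) / R\<^sup>2) * S)"
      using R that by (intro mult_left_mono C) (auto simp: S_def M_def)
    also have "\<dots> < e" using R(2) by (simp only: divide_inverse)
    finally show ?thesis .
  qed
  then show ?thesis by blast
qed

section \<open>Monotone iteration below a constant supersolution\<close>

text \<open>Sublinear growth lets half of a large \<open>M\<close> absorb
  \<open>K * M powr q\<close>, while the other half absorbs \<open>B\<close>. In the application
  \<open>K\<close> is the mass of the Duhamel kernel up to time \<open>T\<close>, of any size, so no
  smallness of \<open>T\<close> is required.\<close>

lemma sublinear_supersolution:
  fixes q B K :: real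
  assumes "0 < q" "q < 1" "0 \<le> B" "0 \<le> K"
  shows "\<exists>M\<ge>0. B + K * M powr q \<le> M"
proof -
  \<comment> \<open>The first summand gives \<open>2 * K \<le> M powr (1 - q)\<close>, the second
    gives \<open>B \<le> M / 2\<close>, and the third makes \<open>M\<close> positive.\<close>
  define M where "M = (2 * K) powr (1 / (1 - q)) + 2 * B + 1"
  have M: "M > 0" using assms by (simp add: M_def add_nonneg_pos)
  have "2 * K \<le> M powr (1 - q)"
  proof (cases "K = 0")
    case False
    have "2 * K = ((2 * K) powr (1 / (1 - q))) powr (1 - q)"
      using assms False by (simp add: powr_powr)
    also have "\<dots> \<le> M powr (1 - q)"
      using assms by (intro powr_mono2) (auto simp: M_def)
    finally show ?thesis .
  qed simp
  then have "2 * K * M powr q \<le> M powr (1 - q) * M powr q"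
    by (intro mult_right_mono) auto
  also have "\<dots> = M" using M by (simp flip: powr_add)
  finally have "K * M powr q \<le> M / 2" by simp
  moreover have "B \<le> M / 2" by (simp add: M_def)
  ultimately show ?thesis using M by (intro exI[of _ M]) linarith
qed

lemma duhamel_mono:
  fixes f g :: "real \<times> 'a::euclidean_space \<Rightarrow> real"
  assumes "0 \<le> \<gamma>" "\<gamma> < min 2 (real DIM('a))"
    and "f \<in> borel_measurable borel" "g \<in> borel_measurable borel"
    and "\<And>p. 0 < fst p \<Longrightarrow> fst p < fst z \<Longrightarrow> 0 \<le> f p \<and> f p \<le> g p \<and> g p \<le> M"
  shows "duhamel \<gamma> f z \<le> duhamel \<gamma> g z"
  unfolding duhamel_def
proof (rule integral_mono)
  show "integrable lborel (\<lambda>p. duhamel_kernel \<gamma> z p * f p)"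
    "integrable lborel (\<lambda>p. duhamel_kernel \<gamma> z p * g p)"
  proof -
    have "\<bar>f p\<bar> \<le> M" "\<bar>g p\<bar> \<le> M" if "0 < fst p" "fst p < fst z" for p
      using assms(5)[OF that] by linarith+
    then show "integrable lborel (\<lambda>p. duhamel_kernel \<gamma> z p * f p)"
      "integrable lborel (\<lambda>p. duhamel_kernel \<gamma> z p * g p)"
      by (auto intro!: integrable_duhamel[where M = M] assms(1-4))
  qed
  show "duhamel_kernel \<gamma> z p * f p \<le> duhamel_kernel \<gamma> z p * g p" for p
    using assms(5)[of p] by (cases "0 < fst p \<and> fst p < fst z")
      (auto simp: duhamel_kernel_def intro!: mult_left_mono)
qed

lemma duhamel_nonneg: "(\<And>p. 0 \<le> f p) \<Longrightarrow> 0 \<le> duhamel \<gamma> f z"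
  unfolding duhamel_def by (intro integral_nonneg_AE) auto

lemma duhamel_LIMSEQ:
  fixes f :: "nat \<Rightarrow> real \<times> 'a::euclidean_space \<Rightarrow> real"
  assumes \<gamma>: "0 \<le> \<gamma>" "\<gamma> < min 2 (real DIM('a))"
    and [measurable]: "\<And>n. f n \<in> borel_measurable borel" "g \<in> borel_measurable borel"
    and M: "\<And>n p. 0 < fst p \<Longrightarrow> fst p < fst z \<Longrightarrow> \<bar>f n p\<bar> \<le> M"
    and lim: "\<And>p. 0 < fst p \<Longrightarrow> fst p < fst z \<Longrightarrow> (\<lambda>n. f n p) \<longlonglongrightarrow> g p"
  shows "(\<lambda>n. duhamel \<gamma> (f n) z) \<longlonglongrightarrow> duhamel \<gamma> g z"
  unfolding duhamel_def
proof (rule integral_dominated_convergence)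
  show "integrable lborel (\<lambda>p. M * duhamel_kernel \<gamma> z p)"
    by (intro integrable_mult_right integrable_duhamel_kernel \<gamma>)
  have "norm (duhamel_kernel \<gamma> z p * f n p) \<le> M * duhamel_kernel \<gamma> z p" for n p
    using M[of p n] by (cases "0 < fst p \<and> fst p < fst z")
      (auto simp: duhamel_kernel_def abs_mult mult.commute intro!: mult_right_mono)
  then show "AE p in lborel. norm (duhamel_kernel \<gamma> z p * f n p) \<le> M * duhamel_kernel \<gamma> z p" for n
    by simp
  have "(\<lambda>n. duhamel_kernel \<gamma> z p * f n p) \<longlonglongrightarrow> duhamel_kernel \<gamma> z p * g p" for p
    using lim[of p] by (cases "0 < fst p \<and> fst p < fst z")
      (auto simp: duhamel_kernel_def intro!: tendsto_mult)
  then show "AE p in lborel. (\<lambda>n. duhamel_kernel \<gamma> z p * f n p) \<longlonglongrightarrow> duhamel_kernel \<gamma> z p * g p"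
    by simp
qed simp_all

text \<open>Continuity is absent from the conclusion because the increasing limit gives only
  measurability; it is recovered afterwards from the fixed-point equation itself.\<close>

lemma sublinear_duhamel_fixed_point:
  fixes H :: "real \<times> 'a::euclidean_space \<Rightarrow> real"
  assumes \<gamma>: "0 \<le> \<gamma>" "\<gamma> < min 2 (real DIM('a))" and q: "0 < q" "q < 1"
    and H: "continuous_on UNIV H" "\<And>p. 0 \<le> H p" "\<And>p. H p \<le> B"
  shows "\<exists>v. v \<in> borel_measurable borel \<and> (\<forall>p. 0 \<le> v p) \<and>
    (\<forall>T. \<exists>M. \<forall>p. 0 < fst p \<longrightarrow> fst p < T \<longrightarrow> \<bar>v p powr q\<bar> \<le> M) \<and>
    (\<forall>z. v z = H z + duhamel \<gamma> (\<lambda>p. v p powr q) z)"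
proof -
  obtain C where C: "C \<ge> 0" "\<And>t (x::'a) \<delta>. \<delta> \<ge> 0 \<Longrightarrow>
      (\<integral>p. duhamel_kernel \<gamma> (t, x) p * indicator {t - \<delta>..} (fst p) \<partial>lborel) \<le> C * \<delta> powr (1 - \<gamma> / 2)"
    using integral_duhamel_kernel_le[OF \<gamma>] by blast
  have kernel_le: "(\<integral>p. duhamel_kernel \<gamma> z p \<partial>lborel) \<le> C * T powr (1 - \<gamma> / 2)"
    if "0 \<le> T" "fst z \<le> T" for T and z :: "real \<times> 'a"
  proof -
    \<comment> \<open>Since \<open>fst z \<le> T\<close>, the window starting at
      \<open>fst z - T\<close> contains all positive times, so the window bound controls the whole
      mass.\<close>
    have eq: "duhamel_kernel \<gamma> z = (\<lambda>p. duhamel_kernel \<gamma> z p * indicator {fst z - T..} (fst p))"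
      using that by (auto simp: duhamel_kernel_def split: split_indicator)
    show ?thesis using C(2)[of T "fst z" "snd z"] that by (subst eq) simp
  qed
  have "0 \<le> B" using H(2,3) order_trans by blast
  then have "\<forall>T. \<exists>M\<ge>0. B + (C * T powr (1 - \<gamma> / 2)) * M powr q \<le> M"
    using C(1) by (intro allI sublinear_supersolution q) auto
  then obtain M where M: "\<And>T. M T \<ge> 0" "\<And>T. B + (C * T powr (1 - \<gamma> / 2)) * M T powr q \<le> M T"
    by metis
  define v where "v n = ((\<lambda>w z. H z + duhamel \<gamma> (\<lambda>p. w p powr q) z) ^^ n) (\<lambda>_. 0)" for n
  have v_0: "v 0 = (\<lambda>_. 0)" and v_Suc: "v (Suc n) = (\<lambda>z. H z + duhamel \<gamma> (\<lambda>p. v n p powr q) z)" for n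
    by (simp_all add: v_def)
  \<comment> \<open>The bound is carried separately for each horizon: at times up to
    \<open>T\<close> the Duhamel integral sees only earlier times, so the single constant
    \<open>M T\<close> reproduces itself. Continuity is carried to make the next source
    measurable.\<close>
  have v_bounds: "continuous_on UNIV (v n) \<and> (\<forall>p. 0 \<le> v n p) \<and> (\<forall>T\<ge>0. \<forall>p. fst p \<le> T \<longrightarrow> v n p \<le> M T)" for n
  proof (induction n)
    case 0
    then show ?case by (simp add: v_0 M)
  next
    case (Suc n)
    then have [measurable]: "v n \<in> borel_measurable borel"
      by (auto intro: borel_measurable_continuous_onI)
    have le: "v n p powr q \<le> M T powr q" if "0 \<le> T" "fst p \<le> T" for T p
    proof -
      have "0 \<le> v n p" "v n p \<le> M T" using Suc that by blast+
      with q show ?thesis by (intro powr_mono2) auto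
    qed
    have "continuous_on UNIV (v (Suc n))"
      unfolding v_Suc
    proof (intro continuous_on_add H continuous_on_duhamel \<gamma>)
      show "\<exists>K. \<forall>p. 0 < fst p \<longrightarrow> fst p < T \<longrightarrow> \<bar>v n p powr q\<bar> \<le> K" for T
        using le[of T] by (intro exI[of _ "M T powr q"]) auto
    qed measurable
    moreover have "0 \<le> v (Suc n) p" for p
      unfolding v_Suc using H(2) by (intro add_nonneg_nonneg duhamel_nonneg) auto
    moreover have "v (Suc n) z \<le> M T" if T: "0 \<le> T" "fst z \<le> T" for T z
    proof -
      have "duhamel \<gamma> (\<lambda>p. v n p powr q) z \<le> M T powr q * (\<integral>p. duhamel_kernel \<gamma> z p \<partial>lborel)"
      proof (rule order_trans[OF abs_ge_self abs_duhamel_le[OF \<gamma>]])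
        show "\<bar>v n p powr q\<bar> \<le> M T powr q" if "fst p < fst z" for p
          using le[of T p] T that by simp
      qed measurable
      also have "\<dots> \<le> M T powr q * (C * T powr (1 - \<gamma> / 2))"
        using T by (intro mult_left_mono kernel_le) auto
      finally have "v (Suc n) z \<le> B + (C * T powr (1 - \<gamma> / 2)) * M T powr q"
        using H(3)[of z] by (simp add: v_Suc mult.commute add_mono)
      also note M(2)
      finally show ?thesis .
    qed
    ultimately show ?case by blast
  qed
  have v_meas [measurable]: "v n \<in> borel_measurable borel" for n
    using v_bounds by (auto intro: borel_measurable_continuous_onI)
  have v_nonneg: "0 \<le> v n p" for n p using v_bounds by blast
  have v_le: "v n p \<le> M T" if "0 \<le> T" "fst p \<le> T" for n p T using v_bounds that by blast
  have v_mono: "v n p \<le> v (Suc n) p" for n p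
  proof (induction n arbitrary: p)
    case 0
    then show ?case using v_nonneg[of 1 p] by (simp add: v_0)
  next
    case (Suc n)
    have "duhamel \<gamma> (\<lambda>p. v n p powr q) p \<le> duhamel \<gamma> (\<lambda>p. v (Suc n) p powr q) p"
    proof (rule duhamel_mono[OF \<gamma>])
      \<comment> \<open>The horizon is \<open>max 0 (fst p)\<close> because the bounds are available
        only for nonnegative horizons.\<close>
      show "0 \<le> v n p' powr q \<and> v n p' powr q \<le> v (Suc n) p' powr q \<and> v (Suc n) p' powr q \<le> M (max 0 (fst p)) powr q"
        if "fst p' < fst p" for p'
        using Suc[of p'] v_nonneg[of n p'] v_nonneg[of "Suc n" p'] v_le[of "max 0 (fst p)" p' "Suc n"] that q
        by (auto intro!: powr_mono2)
    qed measurable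
    then show ?case by (simp add: v_Suc)
  qed
  have "\<exists>l. (\<lambda>n. v n p) \<longlonglongrightarrow> l" for p
  proof -
    have inc: "incseq (\<lambda>n. v n p)" by (intro incseq_SucI v_mono)
    have "\<forall>n. v n p \<le> M (max 0 (fst p))" using v_le by simp
    from incseq_convergent[OF inc this] show ?thesis by blast
  qed
  then obtain w where w: "\<And>p. (\<lambda>n. v n p) \<longlonglongrightarrow> w p" by metis
  have [measurable]: "w \<in> borel_measurable borel"
    by (rule borel_measurable_LIMSEQ_real[OF w]) measurable
  have w_nonneg: "0 \<le> w p" for p
    by (rule LIMSEQ_le_const[OF w]) (auto simp: v_nonneg)
  have w_le: "w p \<le> M T" if "0 \<le> T" "fst p \<le> T" for p T
    by (rule LIMSEQ_le_const2[OF w]) (auto simp: v_le that)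
  have "w z = H z + duhamel \<gamma> (\<lambda>p. w p powr q) z" for z
  proof (rule LIMSEQ_unique)
    show "(\<lambda>n. v (Suc n) z) \<longlonglongrightarrow> w z"
      using w by (rule LIMSEQ_Suc)
    show "(\<lambda>n. v (Suc n) z) \<longlonglongrightarrow> H z + duhamel \<gamma> (\<lambda>p. w p powr q) z"
      unfolding v_Suc
    proof (intro tendsto_add tendsto_const duhamel_LIMSEQ \<gamma>)
      show "\<bar>v n p powr q\<bar> \<le> M (max 0 (fst z)) powr q" if "fst p < fst z" for n p
        using v_nonneg[of n p] v_le[of "max 0 (fst z)" p n] that q by (auto intro!: powr_mono2)
      show "(\<lambda>n. v n p powr q) \<longlonglongrightarrow> w p powr q" for p
        using w v_nonneg q by (intro tendsto_powr2 tendsto_const) auto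
    qed measurable
  qed
  moreover have "\<bar>w p powr q\<bar> \<le> M (max 0 T) powr q" if "fst p < T" for p T
    using w_nonneg[of p] w_le[of "max 0 T" p] that q by (auto intro!: powr_mono2)
  then have "\<exists>K. \<forall>p. 0 < fst p \<longrightarrow> fst p < T \<longrightarrow> \<bar>w p powr q\<bar> \<le> K" for T
    by blast
  ultimately show ?thesis using w_nonneg \<open>w \<in> borel_measurable borel\<close> by blast
qed

section \<open>From the space-time integral back to the mild formulation\<close>

text \<open>Fubini would give integrability in \<open>y\<close> only for almost every
  \<open>\<sigma>\<close>, whereas \<open>mild_solution\<close> asks for it at every
  \<open>\<sigma>\<close>; for a bounded source it follows directly from the weighted Gaussian
  bound.\<close>

lemma integrable_weighted_integrand:
  fixes x :: "real ^ 'n"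
  assumes "0 \<le> \<gamma>" "\<gamma> < real CARD('n)" "t > 0"
    and [measurable]: "\<phi> \<in> borel_measurable borel" and M: "\<And>y. \<bar>\<phi> y\<bar> \<le> M"
  shows "integrable lborel (weighted_integrand \<gamma> t \<phi> x)"
proof -
  define c where "c = (4 * pi * t) powr (real CARD('n) / 2)"
  have e: "exp (- (norm (x - y))\<^sup>2 / (4 * t)) = c * heat_kernel t (x - y)" for y
    using assms(3) by (simp add: c_def heat_kernel_def powr_minus)
  obtain C where C: "\<And>t (x::real ^ 'n). t > 0 \<Longrightarrow>
      (\<integral>\<^sup>+y. ennreal (heat_kernel t (x - y) * norm y powr - \<gamma>) \<partial>lborel) \<le> ennreal (C * t powr (- \<gamma> / 2))"
    using nn_integral_heat_kernel_weighted[where 'a = "real ^ 'n" and \<gamma> = \<gamma>] assms by auto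
  have int: "integrable lborel (\<lambda>y. heat_kernel t (x - y) * norm y powr - \<gamma>)"
  proof (rule integrableI_nonneg)
    show "(\<integral>\<^sup>+y. ennreal (heat_kernel t (x - y) * norm y powr - \<gamma>) \<partial>lborel) < \<infinity>"
      using C[OF assms(3), of x] by (auto intro: le_less_trans)
  qed auto
  have "weighted_integrand \<gamma> t \<phi> x = (\<lambda>y. c * (heat_kernel t (x - y) * norm y powr - \<gamma>) * \<phi> y)"
    by (rule ext) (simp only: weighted_integrand_def e mult.assoc)
  moreover have "integrable lborel (\<lambda>y. c * (heat_kernel t (x - y) * norm y powr - \<gamma>) * \<phi> y)"
  proof (rule Bochner_Integration.integrable_bound)
    show "integrable lborel (\<lambda>y. c * (heat_kernel t (x - y) * norm y powr - \<gamma>) * M)"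
      by (intro integrable_mult_left integrable_mult_right int)
    show "AE y in lborel. norm (c * (heat_kernel t (x - y) * norm y powr - \<gamma>) * \<phi> y)
        \<le> norm (c * (heat_kernel t (x - y) * norm y powr - \<gamma>) * M)"
      unfolding norm_mult
      by (intro AE_I2 mult_left_mono) (auto intro: order_trans[OF M abs_ge_self])
  qed auto
  ultimately show ?thesis by simp
qed

lemma weighted_heat_eq:
  fixes x :: "real ^ 'n"
  shows "weighted_heat \<gamma> t \<phi> x = (\<integral>y. heat_kernel t (x - y) * norm y powr - \<gamma> * \<phi> y \<partial>lborel)"
  unfolding weighted_heat_def weighted_integrand_def heat_kernel_def
  by (subst integral_mult_right_zero[symmetric]) (simp add: mult.assoc)

text \<open>Both claims are Fubini for the space-time integrand: its joint integrability yields
  integrability in time, and the strict inequalities in the kernel match the open interval of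
  integration.\<close>

lemma duhamel_eq_interval_integral:
  fixes x :: "real ^ 'n"
  assumes \<gamma>: "0 \<le> \<gamma>" "\<gamma> < min 2 (real CARD('n))"
    and f: "f \<in> borel_measurable borel" "\<And>p. 0 < fst p \<Longrightarrow> fst p < t \<Longrightarrow> \<bar>f p\<bar> \<le> M"
    and "t \<ge> 0"
  shows "interval_lebesgue_integrable lborel (ereal 0) (ereal t)
      (\<lambda>s. weighted_heat \<gamma> (t - s) (\<lambda>y. f (s, y)) x)" (is ?int)
    and "(LBINT s=ereal 0..ereal t. weighted_heat \<gamma> (t - s) (\<lambda>y. f (s, y)) x) = duhamel \<gamma> f (t, x)" (is ?eq)
proof -
  have int: "integrable (lborel \<Otimes>\<^sub>M lborel) (\<lambda>p. duhamel_kernel \<gamma> (t, x) p * f p)"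
    unfolding lborel_prod using \<gamma> f by (intro integrable_duhamel[where M = M]) auto
  have inner: "(\<integral>y. duhamel_kernel \<gamma> (t, x) (s, y) * f (s, y) \<partial>lborel) =
      indicator {0<..<t} s *\<^sub>R weighted_heat \<gamma> (t - s) (\<lambda>y. f (s, y)) x" for s
    by (cases "0 < s \<and> s < t") (auto simp: duhamel_kernel_def weighted_heat_eq)
  show ?int
    using lborel_pair.integrable_fst'[OF int] \<open>t \<ge> 0\<close>
    by (simp add: inner interval_lebesgue_integrable_def set_integrable_def)
  show ?eq
    using lborel_pair.integral_fst'[OF int] \<open>t \<ge> 0\<close>
    by (simp add: inner interval_lebesgue_integral_def set_lebesgue_integral_def duhamel_def lborel_prod)
qed

theorem theorem1p1:
  fixes u0 :: "(real ^ 'n) \<Rightarrow>\<^sub>C real" and q \<gamma> :: real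
  assumes "0 < q" and "q < 1"
    and "0 < \<gamma>" and "\<gamma> < min 2 (real CARD('n))"
    and "u0 \<in> C0" and "\<And>x. 0 \<le> apply_bcontfun u0 x"
  shows "\<exists>u. mild_solution q \<gamma> u0 u \<and> (\<forall>t\<ge>0. \<forall>x. 0 \<le> apply_bcontfun (u t) x)"
proof -
  have \<gamma>: "0 \<le> \<gamma>" "\<gamma> < min 2 (real DIM(real ^ 'n))"
    using assms by simp_all
  let ?\<phi> = "apply_bcontfun u0"
  have \<phi>_meas [measurable]: "?\<phi> \<in> borel_measurable borel"
    by (intro borel_measurable_continuous_onI) simp
  obtain B where B: "\<And>x. \<bar>?\<phi> x\<bar> \<le> B"
    using bounded_apply_bcontfun[of u0] by (auto simp: bounded_iff)
  define H where "H = heat_flow ?\<phi>"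
  have H_cont: "continuous_on UNIV H"
    unfolding H_def using B by (intro continuous_on_heat_flow) auto
  have "?\<phi> x \<le> B" for x using B[of x] by simp
  from heat_flow_bounds[OF \<phi>_meas assms(6) this]
  have H_bounds: "0 \<le> H p" "H p \<le> B" for p
    unfolding H_def .
  obtain v where v_meas [measurable]: "v \<in> borel_measurable borel"
    and v_nonneg: "\<And>p. 0 \<le> v p"
    and v_bound: "\<And>T. \<exists>M. \<forall>p. 0 < fst p \<longrightarrow> fst p < T \<longrightarrow> \<bar>v p powr q\<bar> \<le> M"
    and v_eq: "\<And>z. v z = H z + duhamel \<gamma> (\<lambda>p. v p powr q) z"
    using sublinear_duhamel_fixed_point[OF \<gamma> assms(1,2) H_cont H_bounds] by blast
  \<comment> \<open>The fixed point regains the continuity lost in the limit: it equals the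
    right-hand side of its equation, which is continuous for any measurable, locally bounded
    source.\<close>
  have v_cont: "continuous_on UNIV v"
  proof -
    have "continuous_on UNIV (\<lambda>z. H z + duhamel \<gamma> (\<lambda>p. v p powr q) z)"
      by (intro continuous_on_add H_cont continuous_on_duhamel \<gamma> v_bound) measurable
    then show ?thesis by (simp flip: v_eq)
  qed
  have v_decay: "\<exists>R. \<forall>t\<le>T. \<forall>x. R \<le> norm x \<longrightarrow> \<bar>v (t, x)\<bar> < e" if "e > 0" for T e
  proof -
    have "e / 2 > 0" using that by simp
    have "\<exists>R. \<forall>t\<le>T. \<forall>x. R \<le> norm x \<longrightarrow> \<bar>H (t, x)\<bar> < e / 2"
      unfolding H_def
    proof (rule heat_flow_decay[OF _ _ _ \<open>e / 2 > 0\<close>])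
      show "\<exists>R. \<forall>x. R \<le> norm x \<longrightarrow> \<bar>?\<phi> x\<bar> < r" if "r > 0" for r
        using assms(5) that unfolding C0_iff_vanishes_at_infinity by blast
    qed (use B in simp_all)
    then obtain R1 where R1: "\<And>t x. t \<le> T \<Longrightarrow> R1 \<le> norm x \<Longrightarrow> \<bar>H (t, x)\<bar> < e / 2"
      by blast
    have "\<exists>R. \<forall>t\<le>T. \<forall>x. R \<le> norm x \<longrightarrow> \<bar>duhamel \<gamma> (\<lambda>p. v p powr q) (t, x)\<bar> < e / 2"
      by (rule duhamel_decay[OF assms(3) \<gamma>(2) _ v_bound \<open>e / 2 > 0\<close>]) measurable
    then obtain R2 where R2: "\<And>t x. t \<le> T \<Longrightarrow> R2 \<le> norm x \<Longrightarrow>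
        \<bar>duhamel \<gamma> (\<lambda>p. v p powr q) (t, x)\<bar> < e / 2"
      by blast
    have "\<bar>v (t, x)\<bar> < e" if "t \<le> T" "max R1 R2 \<le> norm x" for t x
      using R1[of t x] R2[of t x] that unfolding v_eq[of "(t, x)"] by simp
    then show ?thesis by blast
  qed
  obtain u where u: "continuous_on UNIV u" "\<And>t. u t \<in> C0" "\<And>t x. apply_bcontfun (u t) x = v (t, x)"
    using continuous_path_in_C0[OF v_cont v_decay] by auto
  have "mild_solution q \<gamma> u0 u"
    unfolding mild_solution_def
  proof (intro conjI allI impI ballI)
    show "continuous_on {0..} u" using u(1) by (rule continuous_on_subset) simp
    show "u t \<in> C0" for t by (rule u)
  next
    fix T t :: real and x :: "real ^ 'n" assume t: "t \<in> {0..T}"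
    obtain M where M: "\<And>p. 0 < fst p \<Longrightarrow> fst p < t \<Longrightarrow> \<bar>v p powr q\<bar> \<le> M"
      using v_bound[of t] by blast
    have meas: "(\<lambda>p. v p powr q) \<in> borel_measurable borel" by measurable
    note duh = duhamel_eq_interval_integral[where x = x, OF \<gamma>(1) assms(4) meas M]
    show "interval_lebesgue_integrable lborel (ereal 0) (ereal t)
        (\<lambda>\<sigma>. weighted_heat \<gamma> (t - \<sigma>) (\<lambda>y. apply_bcontfun (u \<sigma>) y powr q) x)"
      using duh(1) t by (simp add: u)
    show "apply_bcontfun (u t) x = heat_semigroup t ?\<phi> x +
        (LBINT \<sigma>=ereal 0..ereal t. weighted_heat \<gamma> (t - \<sigma>) (\<lambda>y. apply_bcontfun (u \<sigma>) y powr q) x)"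
      using duh(2) t heat_semigroup_eq_heat_flow[OF _ \<phi>_meas, of t x] v_eq[of "(t, x)"]
      by (simp add: u H_def)
    fix \<sigma> assume \<sigma>: "\<sigma> \<in> {0<..<t}"
    have [measurable]: "apply_bcontfun (u \<sigma>) \<in> borel_measurable borel"
      by (intro borel_measurable_continuous_onI) simp
    show "integrable lborel (weighted_integrand \<gamma> (t - \<sigma>) (\<lambda>y. apply_bcontfun (u \<sigma>) y powr q) x)"
    proof (rule integrable_weighted_integrand)
      show "\<bar>apply_bcontfun (u \<sigma>) y powr q\<bar> \<le> M" for y
        using M[of "(\<sigma>, y)"] \<sigma> by (simp add: u)
    qed (use \<sigma> assms(3,4) in auto)
  qed
  then show ?thesis using v_nonneg u(3) by auto
qed

end
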